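(* Consider the mixed constrained problem (MCP) of minimizing $f(x)$ over $x\in\mathcal{M}$ subject to $g_i(x)\le 0$ for $i\in\mathcal{I}$ and $h_j(x)=0$ for $j\in\mathcal{E}$, with feasible set $\Omega$. Run the Riemannian augmented Lagrangian method (RALM) described in the context with $\epsilon_{\min}=0$, producing a sequence $\{x_k\}_{k=0}^\infty$. Suppose that at each iteration $k$ the subsolver produces a point $x_{k+1}\in\mathcal{M}$ satisfying $$\|\operatorname{grad}_x \mathcal{L}_{\rho_k}(x_{k+1},\lambda^k,\gamma^k)\|\le \epsilon_k .$$ If the sequence $\{x_k\}_{k=0}^\infty$ has a limit point $\overline{x}\in\Omega$ (i.e., some subsequence converges to $\overline{x}$) at which LICQ is satisfied, then $\overline{x}$ satisfies the KKT conditions of the original MCP.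
   Context: Setting. $\mathcal{M}$ is a complete, smooth, finite-dimensional Riemannian manifold with metric $\langle\cdot,\cdot\rangle$, norm $\|\cdot\|$ and Riemannian distance $\mathrm{dist}$. $\mathcal{I}=\{1,\dots,n\}$, $\mathcal{E}=\{n+1,\dots,n+m\}$, and $f$, $g_i$ ($i\in\mathcal{I}$), $h_j$ ($j\in\mathcal{E}$) are twice continuously differentiable functions $\mathcal{M}\to\mathbb{R}$. $\Omega=\{x\in\mathcal{M}: g_i(x)\le 0\ \forall i\in\mathcal{I},\ h_j(x)=0\ \forall j\in\mathcal{E}\}$. $\operatorname{grad}$ is the Riemannian gradient; $\operatorname{grad}_x$ is the Riemannian gradient with respect to the variable $x\in\mathcal{M}$. Vectors in $\mathbb{R}^m$ of multipliers $\gamma$ are indexed by $j\in\mathcal{E}$, vectors in $\mathbb{R}^n$ of multipliers $\lambda$ by $i\in\mathcal{I}$. Active set: $\mathcal{A}(x)=\mathcal{E}\cup\{i\in\mathcal{I}: g_i(x)=0\}$. LICQ at $x$: the family $\{\operatorname{grad} g_i(x)\}_{i\in\mathcal{A}(x)\cap\mathcal{I}}\cup\{\operatorname{grad} h_j(x)\}_{j\in\mathcal{E}}$ is linearly independent in $\mathrm{T}_x\mathcal{M}$. KKT conditions at $x^*\in\Omega$: there exist $\lambda^*\in\mathbb{R}^n$, $\gamma^*\in\mathbb{R}^m$ with $\operatorname{grad} f(x^* )+\sum_{i\in\mathcal{I}}\lambda_i^*\operatorname{grad} g_i(x^* )+\sum_{j\in\mathcal{E}}\gamma_j^*\operatorname{grad}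 h_j(x^* )=0$; $h_j(x^* )=0$ for all $j\in\mathcal{E}$; and $g_i(x^* )\le 0$, $\lambda_i^*\ge 0$, $\lambda_i^* g_i(x^* )=0$ for all $i\in\mathcal{I}$. Augmented Lagrangian: for $\rho>0$, $\gamma\in\mathbb{R}^m$, $\lambda\in\mathbb{R}^n$ with $\lambda\ge 0$, $$\mathcal{L}_\rho(x,\lambda,\gamma)=f(x)+\frac{\rho}{2}\left(\sum_{j\in\mathcal{E}}\Big(h_j(x)+\frac{\gamma_j}{\rho}\Big)^2+\sum_{i\in\mathcal{I}}\max\Big\{0,\frac{\lambda_i}{\rho}+g_i(x)\Big\}^2\right).$$ RALM. Let $\operatorname{clip}_{[a,b]}(t)=\max\{a,\min(b,t)\}$. Inputs: $x_0\in\mathcal{M}$; $\lambda^0\in\mathbb{R}^n$ with $\lambda^0\ge 0$; $\gamma^0\in\mathbb{R}^m$; accuracy tolerance $\epsilon_{\min}\ge 0$; $\epsilon_0>0$; $\rho_0>0$; constants $\theta_\epsilon\in(0,1)$, $\theta_\rho>1$, $\theta_\sigma\in(0,1)$; multiplier bounds $\lambda^{\min}=0$, $\lambda^{\max}\in\mathbb{R}^n$ with $\lambda^{\max}\ge 0$, and $\gamma^{\min},\gamma^{\max}\in\mathbb{R}^m$ with $\gamma_j^{\min}\le\gamma_j^{\max}$ for each $j\in\mathcal{E}$; minimum step size $d_{\min}$. For $k=0,1,\dots$: 1. A subsolver computes $x_{k+1}$, an approximate solution (within tolerance $\epsilon_k$, in the sense specified in the claim) of $\min_{x\in\mathcal{M}}\mathcal{L}_{\rho_k}(x,\lambda^k,\gamma^k)$.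 2. If $\mathrm{dist}(x_k,x_{k+1})<d_{\min}$ and $\epsilon_k\le\epsilon_{\min}$, return $x_{k+1}$. (When $\epsilon_{\min}=0$ this never happens, so the sequence is infinite and $\epsilon_k\to 0$.) 3. $\gamma_j^{k+1}=\operatorname{clip}_{[\gamma_j^{\min},\gamma_j^{\max}]}(\gamma_j^k+\rho_k h_j(x_{k+1}))$ for $j\in\mathcal{E}$; $\lambda_i^{k+1}=\operatorname{clip}_{[\lambda_i^{\min},\lambda_i^{\max}]}(\lambda_i^k+\rho_k g_i(x_{k+1}))$ for $i\in\mathcal{I}$. 4. $\sigma_i^{k+1}=\max\{g_i(x_{k+1}),-\lambda_i^k/\rho_k\}$ for $i\in\mathcal{I}$. 5. $\epsilon_{k+1}=\max\{\epsilon_{\min},\theta_\epsilon\epsilon_k\}$. 6. If $k=0$ or $\max_{j\in\mathcal{E},i\in\mathcal{I}}\{|h_j(x_{k+1})|,|\sigma_i^{k+1}|\}\le\theta_\sigma\max_{j\in\mathcal{E},i\in\mathcal{I}}\{|h_j(x_k)|,|\sigma_i^k|\}$, set $\rho_{k+1}=\rho_k$; otherwise set $\rho_{k+1}=\theta_\rho\rho_k$. *)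

theory Defs
  imports "HOL-Analysis.Analysis"
begin

section \<open>Functions of class C^k on open sets\<close>

text \<open>
  Only meant for open S in a finite-dimensional domain, where having continuous partial
  derivatives in every direction up to order k is the usual notion of class C^k.
\<close>

primrec Ck_on :: "nat \<Rightarrow> 'x::real_normed_vector set \<Rightarrow> ('x \<Rightarrow> 'y::real_normed_vector) \<Rightarrow> bool" where
  "Ck_on 0 S F \<longleftrightarrow> continuous_on S F"
| "Ck_on (Suc k) S F \<longleftrightarrow> (\<forall>y\<in>S. F differentiable (at y)) \<and>
     (\<forall>u. Ck_on k S (\<lambda>y. frechet_derivative F (at y) u))"

definition smooth_on :: "'x::real_normed_vector set \<Rightarrow> ('x \<Rightarrow> 'y::real_normed_vector) \<Rightarrow> bool" where
  "smooth_on S F \<longleftrightarrow> (\<forall>k. Ck_on k S F)"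


section \<open>Smooth manifolds\<close>

text \<open>
  The manifold is the whole type 'a. Charts take values in a finite-dimensional normed
  space 'e, not in a type of class euclidean_space, so that dimension 0 is not excluded.
  A chart is a domain together with a coordinate map, whose values outside the
  domain are irrelevant.
\<close>

type_synonym ('a, 'e) chart = "'a set \<times> ('a \<Rightarrow> 'e)"

definition param :: "('a, 'e) chart \<Rightarrow> 'e \<Rightarrow> 'a" where
  "param c = inv_into (fst c) (snd c)"

definition is_chart :: "('a::topological_space, 'e::real_normed_vector) chart \<Rightarrow> bool" where
  "is_chart c \<longleftrightarrow> open (fst c) \<and> open (snd c ` fst c) \<and>
     homeomorphism (fst c) (snd c ` fst c) (snd c) (param c)"

text \<open>The smooth structure is given by any smooth atlas A, not necessarily a maximal one.\<close>

definition smooth_manifold ::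
  "('a::{t2_space, second_countable_topology}, 'e::real_normed_vector) chart set \<Rightarrow> bool" where
  "smooth_manifold A \<longleftrightarrow>
     (\<exists>B::'e set. finite B \<and> span B = UNIV) \<and>
     (\<forall>c\<in>A. is_chart c) \<and> (\<Union>c\<in>A. fst c) = UNIV \<and>
     (\<forall>c\<in>A. \<forall>c'\<in>A. smooth_on (snd c ` (fst c \<inter> fst c')) (snd c' \<circ> param c))"

definition Ck_function ::
  "('a, 'e::real_normed_vector) chart set \<Rightarrow> nat \<Rightarrow> ('a \<Rightarrow> real) \<Rightarrow> bool" where
  "Ck_function A k F \<longleftrightarrow> (\<forall>c\<in>A. Ck_on k (snd c ` fst c) (F \<circ> param c))"


section \<open>Tangent vectors\<close>

text \<open>
  A tangent vector at p is the family of its coordinate vectors in all charts of the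
  atlas around p, related by the derivatives of the transition maps. The entries at all
  other charts are set to 0, so that each tangent vector has a unique representation.
\<close>

datatype ('a, 'e) tangent = Tangent (tcoord: "('a, 'e) chart \<Rightarrow> 'e")

instantiation tangent :: (type, real_vector) real_vector
begin

definition "0 = Tangent (\<lambda>c. 0)"
definition "v + w = Tangent (\<lambda>c. tcoord v c + tcoord w c)"
definition "- v = Tangent (\<lambda>c. - tcoord v c)"
definition "v - w = Tangent (\<lambda>c. tcoord v c - tcoord w c)"
definition "r *\<^sub>R v = Tangent (\<lambda>c. r *\<^sub>R tcoord v c)"

instance
  by standard
    (simp_all add: zero_tangent_def plus_tangent_def uminus_tangent_def minus_tangent_def
      scaleR_tangent_def algebra_simps)

end

definition tangent_space ::
  "('a, 'e::real_normed_vector) chart set \<Rightarrow> 'a \<Rightarrow> ('a, 'e) tangent set" where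
  "tangent_space A p = {v.
     (\<forall>c. c \<notin> A \<or> p \<notin> fst c \<longrightarrow> tcoord v c = 0) \<and>
     (\<forall>c\<in>A. \<forall>c'\<in>A. p \<in> fst c \<inter> fst c' \<longrightarrow>
        tcoord v c' = frechet_derivative (snd c' \<circ> param c) (at (snd c p)) (tcoord v c))}"

text \<open>The tangent vector at p whose coordinate vector in the chart c is u.\<close>

definition chart_vector ::
  "('a, 'e::real_normed_vector) chart set \<Rightarrow> ('a, 'e) chart \<Rightarrow> 'a \<Rightarrow> 'e \<Rightarrow> ('a, 'e) tangent" where
  "chart_vector A c p u = Tangent (\<lambda>c'. if c' \<in> A \<and> p \<in> fst c'
     then frechet_derivative (snd c' \<circ> param c) (at (snd c p)) u else 0)"


section \<open>Riemannian metrics\<close>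

definition inner_product_on :: "'v::real_vector set \<Rightarrow> ('v \<Rightarrow> 'v \<Rightarrow> real) \<Rightarrow> bool" where
  "inner_product_on T ip \<longleftrightarrow>
     (\<forall>a b. \<forall>u\<in>T. \<forall>v\<in>T. \<forall>w\<in>T. ip (a *\<^sub>R u + b *\<^sub>R v) w = a * ip u w + b * ip v w) \<and>
     (\<forall>u\<in>T. \<forall>v\<in>T. ip u v = ip v u) \<and>
     (\<forall>u\<in>T. u \<noteq> 0 \<longrightarrow> ip u u > 0)"

type_synonym ('a, 'e) metric = "'a \<Rightarrow> ('a, 'e) tangent \<Rightarrow> ('a, 'e) tangent \<Rightarrow> real"

definition riemannian_manifold ::
  "('a::{t2_space, second_countable_topology}, 'e::real_normed_vector) chart set \<Rightarrow>
   ('a, 'e) metric \<Rightarrow> bool" where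
  "riemannian_manifold A G \<longleftrightarrow>
     smooth_manifold A \<and>
     (\<forall>p. inner_product_on (tangent_space A p) (G p)) \<and>
     (\<forall>c\<in>A. \<forall>u v. smooth_on (snd c ` fst c)
        (\<lambda>y. G (param c y) (chart_vector A c (param c y) u) (chart_vector A c (param c y) v)))"

definition tnorm :: "('a, 'e) metric \<Rightarrow> 'a \<Rightarrow> ('a, 'e) tangent \<Rightarrow> real" where
  "tnorm G p v = sqrt (G p v v)"

definition grad ::
  "('a, 'e::real_normed_vector) chart set \<Rightarrow> ('a, 'e) metric \<Rightarrow> ('a \<Rightarrow> real) \<Rightarrow> 'a \<Rightarrow>
   ('a, 'e) tangent" where
  "grad A G F p = (THE w. w \<in> tangent_space A p \<and>
     (\<forall>v\<in>tangent_space A p. \<forall>c\<in>A. p \<in> fst c \<longrightarrow>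
        G p w v = frechet_derivative (F \<circ> param c) (at (snd c p)) (tcoord v c)))"


section \<open>Riemannian distance and completeness\<close>

text \<open>A smooth curve on the interval from 0 to 1 is one that extends smoothly to a neighbourhood.\<close>

definition smooth_curve ::
  "('a::topological_space, 'e::real_normed_vector) chart set \<Rightarrow> (real \<Rightarrow> 'a) \<Rightarrow> bool" where
  "smooth_curve A \<alpha> \<longleftrightarrow> (\<exists>J. open J \<and> {0..1} \<subseteq> J \<and> continuous_on J \<alpha> \<and>
     (\<forall>c\<in>A. smooth_on {t\<in>J. \<alpha> t \<in> fst c} (snd c \<circ> \<alpha>)))"

definition velocity ::
  "('a, 'e::real_normed_vector) chart set \<Rightarrow> (real \<Rightarrow> 'a) \<Rightarrow> real \<Rightarrow> ('a, 'e) tangent" where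
  "velocity A \<alpha> t = Tangent (\<lambda>c. if c \<in> A \<and> \<alpha> t \<in> fst c
     then vector_derivative (snd c \<circ> \<alpha>) (at t) else 0)"

text \<open>Lengths of piecewise smooth curves, i.e. of finite concatenations of smooth curves.\<close>

inductive curve_length ::
  "('a::topological_space, 'e::real_normed_vector) chart set \<Rightarrow> ('a, 'e) metric \<Rightarrow>
   'a \<Rightarrow> 'a \<Rightarrow> real \<Rightarrow> bool" for A G where
  smooth: "smooth_curve A \<alpha> \<Longrightarrow> \<alpha> 0 = p \<Longrightarrow> \<alpha> 1 = q \<Longrightarrow>
    curve_length A G p q (integral {0..1} (\<lambda>t. tnorm G (\<alpha> t) (velocity A \<alpha> t)))"
| concat: "curve_length A G p q l \<Longrightarrow> curve_length A G q r l' \<Longrightarrow> curve_length A G p r (l + l')"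

text \<open>
  Connectedness is not required: the distance between points that no piecewise smooth
  curve joins is the infimum of the empty set, which is \<infinity>.
\<close>

definition rdist ::
  "('a::topological_space, 'e::real_normed_vector) chart set \<Rightarrow> ('a, 'e) metric \<Rightarrow>
   'a \<Rightarrow> 'a \<Rightarrow> ereal" where
  "rdist A G p q = (INF l\<in>{l. curve_length A G p q l}. ereal l)"

definition complete_riemannian_manifold ::
  "('a::{t2_space, second_countable_topology}, 'e::real_normed_vector) chart set \<Rightarrow>
   ('a, 'e) metric \<Rightarrow> bool" where
  "complete_riemannian_manifold A G \<longleftrightarrow>
     riemannian_manifold A G \<and>
     (\<forall>s::nat \<Rightarrow> 'a.
        (\<forall>e>0. \<exists>N. \<forall>i\<ge>N. \<forall>j\<ge>N. rdist A G (s i) (s j) < ereal e) \<longrightarrow>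
        (\<exists>p. (\<lambda>i. rdist A G (s i) p) \<longlonglongrightarrow> 0))"


section \<open>Mixed constrained problems\<close>

text \<open>
  The indices of the inequality constraints g are 1, ..., n, those of the equality
  constraints h are n + 1, ..., n + m. A vector of multipliers is a function on nat of which
  only the values at the respective indices matter.
\<close>

definition feasible_set ::
  "nat \<Rightarrow> nat \<Rightarrow> (nat \<Rightarrow> 'a \<Rightarrow> real) \<Rightarrow> (nat \<Rightarrow> 'a \<Rightarrow> real) \<Rightarrow> 'a set" where
  "feasible_set n m g h = {x. (\<forall>i\<in>{1..n}. g i x \<le> 0) \<and> (\<forall>j\<in>{n+1..n+m}. h j x = 0)}"

definition active_set :: "nat \<Rightarrow> nat \<Rightarrow> (nat \<Rightarrow> 'a \<Rightarrow> real) \<Rightarrow> 'a \<Rightarrow> nat set" where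
  "active_set n m g x = {n+1..n+m} \<union> {i\<in>{1..n}. g i x = 0}"

text \<open>Independence of a finite family, not of the set of its members: repetitions are dependent.\<close>

definition independent_family :: "'i set \<Rightarrow> ('i \<Rightarrow> 'v::real_vector) \<Rightarrow> bool" where
  "independent_family I v \<longleftrightarrow>
     (\<forall>a::'i \<Rightarrow> real. (\<Sum>i\<in>I. a i *\<^sub>R v i) = 0 \<longrightarrow> (\<forall>i\<in>I. a i = 0))"

definition LICQ ::
  "('a, 'e::real_normed_vector) chart set \<Rightarrow> ('a, 'e) metric \<Rightarrow> nat \<Rightarrow> nat \<Rightarrow>
   (nat \<Rightarrow> 'a \<Rightarrow> real) \<Rightarrow> (nat \<Rightarrow> 'a \<Rightarrow> real) \<Rightarrow> 'a \<Rightarrow> bool" where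
  "LICQ A G n m g h x \<longleftrightarrow> independent_family (active_set n m g x)
     (\<lambda>l. if l \<in> {1..n} then grad A G (g l) x else grad A G (h l) x)"

definition KKT ::
  "('a, 'e::real_normed_vector) chart set \<Rightarrow> ('a, 'e) metric \<Rightarrow> nat \<Rightarrow> nat \<Rightarrow>
   ('a \<Rightarrow> real) \<Rightarrow> (nat \<Rightarrow> 'a \<Rightarrow> real) \<Rightarrow> (nat \<Rightarrow> 'a \<Rightarrow> real) \<Rightarrow> 'a \<Rightarrow> bool" where
  "KKT A G n m f g h x \<longleftrightarrow> (\<exists>lam gam :: nat \<Rightarrow> real.
     grad A G f x + (\<Sum>i\<in>{1..n}. lam i *\<^sub>R grad A G (g i) x)
       + (\<Sum>j\<in>{n+1..n+m}. gam j *\<^sub>R grad A G (h j) x) = 0 \<and>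
     (\<forall>j\<in>{n+1..n+m}. h j x = 0) \<and>
     (\<forall>i\<in>{1..n}. g i x \<le> 0 \<and> lam i \<ge> 0 \<and> lam i * g i x = 0))"


section \<open>The Riemannian augmented Lagrangian method\<close>

definition aug_lagrangian ::
  "nat \<Rightarrow> nat \<Rightarrow> ('a \<Rightarrow> real) \<Rightarrow> (nat \<Rightarrow> 'a \<Rightarrow> real) \<Rightarrow> (nat \<Rightarrow> 'a \<Rightarrow> real) \<Rightarrow>
   real \<Rightarrow> 'a \<Rightarrow> (nat \<Rightarrow> real) \<Rightarrow> (nat \<Rightarrow> real) \<Rightarrow> real" where
  "aug_lagrangian n m f g h \<rho> x lam gam = f x + \<rho> / 2 *
     ((\<Sum>j\<in>{n+1..n+m}. (h j x + gam j / \<rho>)\<^sup>2) + (\<Sum>i\<in>{1..n}. (max 0 (lam i / \<rho> + g i x))\<^sup>2))"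

definition clip :: "real \<Rightarrow> real \<Rightarrow> real \<Rightarrow> real" where
  "clip a b t = max a (min b t)"

text \<open>
  The maximum of all |h j x| and |s i|. Inserting 0 only gives the value 0 in the case
  that there are no constraints at all.
\<close>

definition residual ::
  "nat \<Rightarrow> nat \<Rightarrow> (nat \<Rightarrow> 'a \<Rightarrow> real) \<Rightarrow> 'a \<Rightarrow> (nat \<Rightarrow> real) \<Rightarrow> real" where
  "residual n m h x s =
     Max (insert 0 ((\<lambda>j. \<bar>h j x\<bar>) ` {n+1..n+m} \<union> (\<lambda>i. \<bar>s i\<bar>) ` {1..n}))"

definition ralm_inputs ::
  "nat \<Rightarrow> nat \<Rightarrow> (nat \<Rightarrow> real) \<Rightarrow> real \<Rightarrow> real \<Rightarrow> real \<Rightarrow> real \<Rightarrow> real \<Rightarrow> real \<Rightarrow>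
   (nat \<Rightarrow> real) \<Rightarrow> (nat \<Rightarrow> real) \<Rightarrow> (nat \<Rightarrow> real) \<Rightarrow> bool" where
  "ralm_inputs n m lam0 eps_min eps0 rho0 th_eps th_rho th_sig lam_max gam_min gam_max \<longleftrightarrow>
     (\<forall>i\<in>{1..n}. lam0 i \<ge> 0) \<and> eps_min \<ge> 0 \<and> eps0 > 0 \<and> rho0 > 0 \<and>
     0 < th_eps \<and> th_eps < 1 \<and> th_rho > 1 \<and> 0 < th_sig \<and> th_sig < 1 \<and>
     (\<forall>i\<in>{1..n}. lam_max i \<ge> 0) \<and> (\<forall>j\<in>{n+1..n+m}. gam_min j \<le> gam_max j)"

text \<open>
  The sequences x, lam, gam, sig, eps, rho are those of a run that never meets the stopping
  criterion, except that nothing is said about how the subsolver chooses x (Suc k).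
  The initial values are x 0, lam 0, gam 0, eps 0 and rho 0; sig 0 is not used.
\<close>

definition infinite_ralm_run ::
  "('a::topological_space, 'e::real_normed_vector) chart set \<Rightarrow> ('a, 'e) metric \<Rightarrow> nat \<Rightarrow> nat \<Rightarrow>
   (nat \<Rightarrow> 'a \<Rightarrow> real) \<Rightarrow> (nat \<Rightarrow> 'a \<Rightarrow> real) \<Rightarrow>
   real \<Rightarrow> real \<Rightarrow> real \<Rightarrow> real \<Rightarrow> (nat \<Rightarrow> real) \<Rightarrow> (nat \<Rightarrow> real) \<Rightarrow> (nat \<Rightarrow> real) \<Rightarrow> real \<Rightarrow>
   (nat \<Rightarrow> 'a) \<Rightarrow> (nat \<Rightarrow> nat \<Rightarrow> real) \<Rightarrow> (nat \<Rightarrow> nat \<Rightarrow> real) \<Rightarrow> (nat \<Rightarrow> nat \<Rightarrow> real) \<Rightarrow>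
   (nat \<Rightarrow> real) \<Rightarrow> (nat \<Rightarrow> real) \<Rightarrow> bool" where
  "infinite_ralm_run A G n m g h
     eps_min th_eps th_rho th_sig lam_max gam_min gam_max d_min x lam gam sig eps rho \<longleftrightarrow>
     (\<forall>k.
       \<not> (rdist A G (x k) (x (Suc k)) < ereal d_min \<and> eps k \<le> eps_min) \<and>
       (\<forall>j\<in>{n+1..n+m}.
          gam (Suc k) j = clip (gam_min j) (gam_max j) (gam k j + rho k * h j (x (Suc k)))) \<and>
       (\<forall>i\<in>{1..n}. lam (Suc k) i = clip 0 (lam_max i) (lam k i + rho k * g i (x (Suc k)))) \<and>
       (\<forall>i\<in>{1..n}. sig (Suc k) i = max (g i (x (Suc k))) (- (lam k i / rho k))) \<and>
       eps (Suc k) = max eps_min (th_eps * eps k) \<and>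
       rho (Suc k) =
         (if k = 0 \<or> residual n m h (x (Suc k)) (sig (Suc k)) \<le> th_sig * residual n m h (x k) (sig k)
          then rho k else th_rho * rho k))"

end

theory Submission
  imports Defs
begin

text \<open>
  The limit is taken entirely in one chart around the limit point. Testing the approximate
  stationarity against a fixed coordinate vector u bounds the derivative of the augmented
  Lagrangian in direction u by eps k times the length of u at the iterate, which stays bounded.
  LICQ yields a family of tangent vectors dual to the active constraint gradients at the limit point.
  Tested on it, the system for the multipliers has a coefficient matrix converging to the
  identity, so the multipliers themselves converge, without any compactness argument.
  The multipliers of inactive constraints vanish eventually: either the penalty parameter tends to
  infinity, or it is eventually constant and the residual contracts geometrically.
\<close>

section \<open>Inner products on subspaces\<close>

text \<open>The inner product lives on a subset of the type because each tangent space is one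
  subspace of the type \<open>tangent\<close>, carrying its own inner product.\<close>

locale subspace_inner_product =
  fixes T :: "'v::real_vector set" and ip :: "'v \<Rightarrow> 'v \<Rightarrow> real"
  assumes subspace: "subspace T" and ip: "inner_product_on T ip"
begin

lemma ip_comb: "u \<in> T \<Longrightarrow> v \<in> T \<Longrightarrow> w \<in> T \<Longrightarrow>
    ip (a *\<^sub>R u + b *\<^sub>R v) w = a * ip u w + b * ip v w"
  using ip unfolding inner_product_on_def by simp

lemma ip_commute: "u \<in> T \<Longrightarrow> v \<in> T \<Longrightarrow> ip u v = ip v u"
  using ip unfolding inner_product_on_def by metis

lemma ip_pos: "u \<in> T \<Longrightarrow> u \<noteq> 0 \<Longrightarrow> ip u u > 0"
  using ip unfolding inner_product_on_def by simp

lemma ip_add: "u \<in> T \<Longrightarrow> v \<in> T \<Longrightarrow> w \<in> T \<Longrightarrow> ip (u + v) w = ip u w + ip v w"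
  using ip_comb[of u v w 1 1] by simp

lemma ip_diff: "u \<in> T \<Longrightarrow> v \<in> T \<Longrightarrow> w \<in> T \<Longrightarrow> ip (u - v) w = ip u w - ip v w"
  using ip_comb[of u v w 1 "-1"] by simp

lemma ip_scaleR: "u \<in> T \<Longrightarrow> w \<in> T \<Longrightarrow> ip (a *\<^sub>R u) w = a * ip u w"
  using ip_comb[of u u w a 0] by simp

lemma ip_zero: "w \<in> T \<Longrightarrow> ip 0 w = 0"
  using ip_scaleR[of w w 0] by simp

lemma ip_nonneg: "u \<in> T \<Longrightarrow> ip u u \<ge> 0"
  using ip_pos[of u] ip_zero[of u] by (cases "u = 0") auto

lemma ip_sum:
  assumes "\<And>i. i \<in> I \<Longrightarrow> w i \<in> T" "v \<in> T"
  shows "ip (\<Sum>i\<in>I. a i *\<^sub>R w i) v = (\<Sum>i\<in>I. a i * ip (w i) v)"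
proof (cases "finite I")
  case True
  then show ?thesis using assms(1)
  proof (induction I rule: finite_induct)
    case empty
    then show ?case using ip_zero assms(2) by simp
  next
    case (insert j I)
    then show ?case
      using assms(2) subspace
      by (simp add: ip_add ip_scaleR subspace_sum subspace_scale)
  qed
qed (simp add: ip_zero assms(2))

text \<open>The component of \<open>u\<close> orthogonal to \<open>v\<close> has nonnegative squared
  length.\<close>

lemma Cauchy_Schwarz:
  assumes "u \<in> T" "v \<in> T"
  shows "\<bar>ip u v\<bar> \<le> sqrt (ip u u) * sqrt (ip v v)"
proof (cases "v = 0")
  case True
  then show ?thesis
    using assms ip_zero[of u] ip_zero[of v] ip_commute[of u 0] by simp
next
  case False
  define t where "t = ip u v / ip v v"
  have pos: "ip v v > 0"
    using False assms ip_pos by blast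
  have tv: "t *\<^sub>R v \<in> T" "u - t *\<^sub>R v \<in> T"
    using assms subspace by (auto intro: subspace_scale subspace_diff)
  have "0 \<le> ip (u - t *\<^sub>R v) (u - t *\<^sub>R v)"
    using tv ip_nonneg by blast
  also have "\<dots> = ip u u - t * ip u v - t * (ip u v - t * ip v v)"
    using assms tv
    by (simp add: ip_diff ip_scaleR ip_commute[of u "u - t *\<^sub>R v"] ip_commute[of v "u - t *\<^sub>R v"]
        ip_commute[of v u])
  also have "\<dots> = ip u u - (ip u v)\<^sup>2 / ip v v"
    using pos by (simp add: t_def field_simps power2_eq_square)
  finally have "(ip u v)\<^sup>2 \<le> ip u u * ip v v"
    using pos by (simp add: field_simps)
  then show ?thesis
    by (metis real_sqrt_abs real_sqrt_le_mono real_sqrt_mult)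
qed

lemma eq_if_ip_eq:
  assumes "u \<in> T" "v \<in> T" "\<And>w. w \<in> T \<Longrightarrow> ip u w = ip v w"
  shows "u = v"
proof (rule ccontr)
  assume "u \<noteq> v"
  moreover have "u - v \<in> T"
    using assms subspace by (auto intro: subspace_diff)
  ultimately show False
    using ip_pos[of "u - v"] ip_diff[of u v "u - v"] assms by auto
qed

text \<open>Induction by orthogonalisation. The induction hypothesis is used twice: for
  \<open>l\<close> itself, and for the functional \<open>\<lambda>v. ip v b\<close>, whose
  representer \<open>p\<close> is the orthogonal projection of \<open>b\<close> onto
  \<open>span B\<close>. The representer of \<open>l\<close> is then corrected along
  \<open>b - p\<close>. Since \<open>B\<close> may be linearly dependent, \<open>b - p\<close> may
  vanish.\<close>

lemma Riesz_span:
  assumes "finite B" "B \<subseteq> T"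
    and add: "\<And>u v. u \<in> T \<Longrightarrow> v \<in> T \<Longrightarrow> l (u + v) = l u + l v"
    and scale: "\<And>a u. u \<in> T \<Longrightarrow> l (a *\<^sub>R u) = a * (l u :: real)"
  shows "\<exists>w\<in>span B. \<forall>v\<in>span B. ip w v = l v"
  using assms
proof (induction B arbitrary: l rule: finite_induct)
  case empty
  have "l 0 = 0"
    using empty.prems(2)[of 0 0] subspace by (simp add: subspace_0)
  then show ?case
    using ip_zero subspace by (simp add: subspace_0)
next
  case (insert b B)
  have BT: "span B \<subseteq> T" "b \<in> T"
    using insert.prems(1) span_minimal[OF _ subspace] by auto
  obtain w where w: "w \<in> span B" "\<And>v. v \<in> span B \<Longrightarrow> ip w v = l v"
    using insert.IH[OF _ insert.prems(2,3)] insert.prems(1) by blast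
  obtain p where p: "p \<in> span B" "\<And>v. v \<in> span B \<Longrightarrow> ip p v = ip v b"
    using insert.IH[of "\<lambda>v. ip v b", OF _ ip_add ip_scaleR] insert.prems(1) BT(2) by blast
  define e where "e = b - p"
  have eT: "e \<in> T"
    unfolding e_def using BT p subspace by (auto intro: subspace_diff)
  have orth: "ip e v = 0" if "v \<in> span B" for v
  proof -
    have "v \<in> T" "p \<in> T"
      using that p(1) BT(1) by auto
    then show ?thesis
      using ip_diff[OF BT(2)] ip_commute[OF BT(2)] p(2)[OF that] by (simp add: e_def)
  qed
  have e_span: "e \<in> span (insert b B)"
    unfolding e_def using p(1) by (meson insertI1 span_base span_diff span_mono subsetD subset_insertI)
  \<comment> \<open>If \<open>e = 0\<close>, then \<open>b\<close> already lies in
    \<open>span B\<close> and no correction is due; the value 0 fits because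
    \<open>l 0 = 0\<close>.\<close>
  define a where "a = (if e = 0 then 0 else l e / ip e e)"
  have "l 0 = 0"
    using insert.prems(2)[of 0 0] subspace by (simp add: subspace_0)
  then have a: "a * ip e e = l e"
    using ip_pos[OF eT] by (auto simp: a_def)
  show ?case
  proof (intro bexI ballI)
    show "w + a *\<^sub>R e \<in> span (insert b B)"
      using w(1) e_span by (meson span_add span_mono span_scale subsetD subset_insertI)
    fix v assume "v \<in> span (insert b B)"
    then obtain k where k: "v - k *\<^sub>R b \<in> span B"
      using span_breakdown_eq by blast
    \<comment> \<open>Splitting \<open>v\<close> along \<open>e\<close> rather than along
      \<open>b\<close> leaves a remainder in \<open>span B\<close>, where \<open>w\<close>
      represents \<open>l\<close> and to which \<open>e\<close> is orthogonal.\<close>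
    define z where "z = v - k *\<^sub>R e"
    have "z = (v - k *\<^sub>R b) + k *\<^sub>R p"
      by (simp add: z_def e_def algebra_simps)
    then have z: "z \<in> span B"
      using k p(1) by (simp add: span_add span_scale)
    have v: "v = z + k *\<^sub>R e"
      by (simp add: z_def)
    have T: "z \<in> T" "w \<in> T" "a *\<^sub>R e \<in> T" "k *\<^sub>R e \<in> T" "w + a *\<^sub>R e \<in> T"
      using z w(1) BT eT subspace by (auto intro: subspace_scale subspace_add)
    have W: "ip (w + a *\<^sub>R e) z = l z" "ip (w + a *\<^sub>R e) e = l e"
      using T eT orth[OF z] orth[OF w(1)] w(2)[OF z] a ip_commute[OF T(2) eT]
      by (simp_all add: ip_add ip_scaleR)
    have "ip (w + a *\<^sub>R e) v = ip v (w + a *\<^sub>R e)"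
      using T v subspace by (intro ip_commute) (auto intro: subspace_add)
    also have "\<dots> = ip (w + a *\<^sub>R e) z + k * ip (w + a *\<^sub>R e) e"
      using ip_comb[OF T(1) eT T(5), of 1 k] ip_commute[OF T(1,5)] ip_commute[OF eT T(5)]
      by (metis v scaleR_one mult_1)
    also have "\<dots> = l v"
      using W T eT insert.prems(2,3) by (simp add: v)
    finally show "ip (w + a *\<^sub>R e) v = l v" .
  qed
qed

text \<open>Subtract from \<open>w t\<close> its orthogonal projection onto the span of the other
  members. The remainder \<open>e\<close> is orthogonal to these, independence makes it nonzero, and
  dividing it by \<open>ip e e\<close> normalises the product with \<open>w t\<close> to 1.\<close>

lemma dual_vector:
  assumes "finite S" "independent_family S w" "\<And>s. s \<in> S \<Longrightarrow> w s \<in> T" "t \<in> S"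
  shows "\<exists>u\<in>T. \<forall>s\<in>S. ip (w s) u = (if s = t then 1 else 0)"
proof -
  define B where "B = w ` (S - {t})"
  have B: "finite B" "B \<subseteq> T"
    using assms by (auto simp: B_def)
  have BT: "span B \<subseteq> T"
    using B(2) subspace by (rule span_minimal)
  have wt: "w t \<in> T"
    using assms by blast
  obtain p where p: "p \<in> span B" "\<And>v. v \<in> span B \<Longrightarrow> ip p v = ip v (w t)"
    using Riesz_span[OF B, of "\<lambda>v. ip v (w t)", OF ip_add ip_scaleR] wt by blast
  define e where "e = w t - p"
  have eT: "e \<in> T"
    unfolding e_def using BT p wt subspace by (auto intro: subspace_diff)
  have orth: "ip v e = 0" if "v \<in> span B" for v
  proof -
    have "v \<in> T" "p \<in> T"
      using that p(1) BT by auto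
    then show ?thesis
      using ip_commute[OF _ eT, of v] ip_diff[of "w t" p v] ip_commute[of v "w t"] p(2)[OF that] wt
      by (simp add: e_def)
  qed
  \<comment> \<open>The projection is written as a sum over indices rather than over the image set,
    the form in which \<open>independent_family\<close> speaks of linear relations.\<close>
  have "\<exists>a. p = (\<Sum>s\<in>S - {t}. a s *\<^sub>R w s)"
    using p(1) unfolding B_def
  proof (induction rule: span_induct_alt)
    case base
    show ?case by (rule exI[of _ "\<lambda>_. 0"]) simp
  next
    case (step c v z)
    then obtain a s where a: "z = (\<Sum>s\<in>S - {t}. a s *\<^sub>R w s)" "s \<in> S - {t}" "v = w s"
      by blast
    have "c *\<^sub>R v + z = (\<Sum>r\<in>S - {t}. (if r = s then c *\<^sub>R w r else 0) + a r *\<^sub>R w r)"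
      using a assms(1) by (simp add: sum.distrib sum.delta)
    also have "\<dots> = (\<Sum>r\<in>S - {t}. (a r + (if r = s then c else 0)) *\<^sub>R w r)"
      by (intro sum.cong) (auto simp: algebra_simps)
    finally show ?case
      by (intro exI[of _ "\<lambda>r. a r + (if r = s then c else 0)"])
  qed
  then obtain a where a: "p = (\<Sum>s\<in>S - {t}. a s *\<^sub>R w s)" ..
  have "e \<noteq> 0"
  proof
    assume "e = 0"
    \<comment> \<open>If \<open>e\<close> vanished, the coefficient -1 at \<open>t\<close> would
      give a nontrivial relation.\<close>
    have "(\<Sum>s\<in>S. (if s = t then -1 else a s) *\<^sub>R w s) = - w t + (\<Sum>s\<in>S - {t}. a s *\<^sub>R w s)"
      using assms by (subst sum.remove[of _ t]) (auto intro!: sum.cong)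
    also have "\<dots> = 0"
      using a \<open>e = 0\<close> by (simp add: e_def)
    finally have "(if t = t then -1 else a t) = 0"
      using assms(2,4) unfolding independent_family_def by fast
    then show False
      by simp
  qed
  then have pos: "ip e e > 0"
    using ip_pos eT by blast
  have "w t = e + p"
    by (simp add: e_def)
  then have wte: "ip (w t) e = ip e e"
    using orth[OF p(1)] ip_add[OF eT subsetD[OF BT p(1)] eT] by simp
  show ?thesis
  proof (intro bexI ballI)
    show "(1 / ip e e) *\<^sub>R e \<in> T"
      using eT subspace by (auto intro: subspace_scale)
    fix s assume s: "s \<in> S"
    have "ip (w s) e = (if s = t then ip e e else 0)"
    proof (cases "s = t")
      case False
      then have "w s \<in> span B"
        using s by (auto simp: B_def intro: span_base)
      then show ?thesis
        using False orth by simp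
    qed (simp add: wte)
    moreover have "ip (w s) ((1 / ip e e) *\<^sub>R e) = 1 / ip e e * ip (w s) e"
      using ip_commute[of "w s" "(1 / ip e e) *\<^sub>R e"] ip_scaleR[of e "w s" "1 / ip e e"]
        ip_commute[of "w s" e] s assms(3) eT subspace by (simp add: subspace_scale)
    ultimately show "ip (w s) ((1 / ip e e) *\<^sub>R e) = (if s = t then 1 else 0)"
      using pos by simp
  qed
qed

end

section \<open>Charts and tangent vectors\<close>

text \<open>The limits are taken along \<open>nhds\<close> rather than \<open>at\<close>, so that
  they compose with sequences that may hit their limit.\<close>

lemma is_chartD:
  fixes c :: "('a::t2_space, 'e::real_normed_vector) chart"
  assumes "is_chart c" "p \<in> fst c"
  shows "param c (snd c p) = p"
    and "eventually (\<lambda>z. z \<in> snd c ` fst c) (nhds (snd c p))"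
    and "(snd c \<longlongrightarrow> snd c p) (nhds p)"
    and "(param c \<longlongrightarrow> p) (nhds (snd c p))"
proof -
  have h: "homeomorphism (fst c) (snd c ` fst c) (snd c) (param c)"
    and o: "open (fst c)" "open (snd c ` fst c)"
    using assms(1) unfolding is_chart_def by auto
  show 1: "param c (snd c p) = p"
    using h assms(2) unfolding homeomorphism_def by blast
  show "eventually (\<lambda>z. z \<in> snd c ` fst c) (nhds (snd c p))"
    using o assms(2) by (intro eventually_nhds_in_open) auto
  have "isCont (snd c) p" "isCont (param c) (snd c p)"
    using h o assms(2) unfolding homeomorphism_def
    by (auto simp: continuous_on_eq_continuous_at)
  then show "(snd c \<longlongrightarrow> snd c p) (nhds p)" "(param c \<longlongrightarrow> p) (nhds (snd c p))"
    using 1 tendsto_at_iff_tendsto_nhds[of "snd c" p] tendsto_at_iff_tendsto_nhds[of "param c" "snd c p"]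
    unfolding continuous_at by simp_all
qed

lemma smooth_manifold_chart: "smooth_manifold A \<Longrightarrow> c \<in> A \<Longrightarrow> is_chart c"
  unfolding smooth_manifold_def by blast

lemma transition_has_derivative:
  assumes "smooth_manifold A" "c \<in> A" "c' \<in> A" "p \<in> fst c" "p \<in> fst c'"
  shows "((snd c' \<circ> param c) has_derivative
    frechet_derivative (snd c' \<circ> param c) (at (snd c p))) (at (snd c p))"
proof -
  have "Ck_on 1 (snd c ` (fst c \<inter> fst c')) (snd c' \<circ> param c)"
    using assms unfolding smooth_manifold_def smooth_on_def by blast
  then show ?thesis
    using assms by (auto simp: frechet_derivative_works)
qed

lemma has_derivative_change_chart:
  fixes F :: "'a::{t2_space, second_countable_topology} \<Rightarrow> 'y::real_normed_vector"
  assumes "smooth_manifold A" "c \<in> A" "c' \<in> A" "p \<in> fst c" "p \<in> fst c'"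
    and "((F \<circ> param c) has_derivative D) (at (snd c p))"
  shows "((F \<circ> param c') has_derivative
    (\<lambda>u. D (frechet_derivative (snd c \<circ> param c') (at (snd c' p)) u))) (at (snd c' p))"
proof -
  let ?T = "frechet_derivative (snd c \<circ> param c') (at (snd c' p))"
  note c = is_chartD[OF smooth_manifold_chart[OF assms(1,2)]]
  note c' = is_chartD[OF smooth_manifold_chart[OF assms(1,3)] assms(5)]
  have "((F \<circ> param c) \<circ> (snd c \<circ> param c') has_derivative D \<circ> ?T) (at (snd c' p))"
    using transition_has_derivative[OF assms(1,3,2,5,4)] assms(6) c'(1)
    by (intro diff_chain_at) (auto simp: comp_def)
  moreover have "open (fst c)"
    using smooth_manifold_chart[OF assms(1,2)] unfolding is_chart_def by blast
  then have ev: "eventually (\<lambda>z. param c' z \<in> fst c) (nhds (snd c' p))"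
    using c'(4) assms(4) by (intro topological_tendstoD)
  have "eventually (\<lambda>z. ((F \<circ> param c) \<circ> (snd c \<circ> param c')) z = (F \<circ> param c') z) (nhds (snd c' p))"
    using ev by eventually_elim (simp add: c(1))
  then have ev': "eventually (\<lambda>z. ((F \<circ> param c) \<circ> (snd c \<circ> param c')) z = (F \<circ> param c') z) (at (snd c' p))"
    by (simp add: eventually_nhds_conv_at)
  ultimately have "((F \<circ> param c') has_derivative D \<circ> ?T) (at (snd c' p))"
    using c(1)[OF assms(4)] c'(1)
    by (elim has_derivative_transform_eventually[OF _ ev']) simp_all
  then show ?thesis
    by (simp only: comp_def)
qed

lemma frechet_derivative_chart_id:
  assumes "smooth_manifold A" "c \<in> A" "p \<in> fst c"
  shows "frechet_derivative (snd c \<circ> param c) (at (snd c p)) = (\<lambda>u. u)"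
proof -
  note c = is_chartD[OF smooth_manifold_chart[OF assms(1,2)]]
  have "eventually (\<lambda>z. z = (snd c \<circ> param c) z) (nhds (snd c p))"
    using c(2)[OF assms(3)] by eventually_elim (auto simp: c(1))
  then have "((snd c \<circ> param c) has_derivative (\<lambda>u. u)) (at (snd c p))"
    using c(1)[OF assms(3)]
    by (intro has_derivative_transform_eventually[OF has_derivative_ident])
      (auto simp: eventually_nhds_conv_at)
  then show ?thesis
    by (rule frechet_derivative_at[symmetric])
qed

lemma tcoord_chart_vector:
  assumes "smooth_manifold A" "c \<in> A" "p \<in> fst c"
  shows "tcoord (chart_vector A c p u) c = u"
  using assms(2,3) by (simp add: chart_vector_def frechet_derivative_chart_id[OF assms])

text \<open>Compatibility of the entries in \<open>d\<close> and \<open>d'\<close> is the chain rule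
  for the transition from \<open>c\<close> to \<open>d\<close> followed by the one from
  \<open>d\<close> to \<open>d'\<close>.\<close>

lemma chart_vector_in_tangent_space:
  assumes "smooth_manifold A" "c \<in> A" "p \<in> fst c"
  shows "chart_vector A c p u \<in> tangent_space A p"
proof -
  have "frechet_derivative (snd d' \<circ> param c) (at (snd c p)) u =
      frechet_derivative (snd d' \<circ> param d) (at (snd d p))
        (frechet_derivative (snd d \<circ> param c) (at (snd c p)) u)"
    if "d \<in> A" "d' \<in> A" "p \<in> fst d" "p \<in> fst d'" for d d'
    using has_derivative_change_chart[OF assms(1) that(1) assms(2) that(3) assms(3)
        transition_has_derivative[OF assms(1) that]]
    by (metis frechet_derivative_at)
  then show ?thesis
    unfolding tangent_space_def chart_vector_def mem_Collect_eq tangent.sel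
    by (simp only: Int_iff if_True if_False simp_thms conj_absorb split: if_split) blast
qed

lemma chart_vector_tcoord:
  assumes "c \<in> A" "p \<in> fst c" "v \<in> tangent_space A p"
  shows "chart_vector A c p (tcoord v c) = v"
proof -
  have "tcoord (chart_vector A c p (tcoord v c)) c' = tcoord v c'" for c'
  proof (cases "c' \<in> A \<and> p \<in> fst c'")
    case True
    then have "tcoord v c' = frechet_derivative (snd c' \<circ> param c) (at (snd c p)) (tcoord v c)"
      using assms unfolding tangent_space_def mem_Collect_eq by (metis IntI)
    then show ?thesis
      using True by (simp add: chart_vector_def)
  next
    case False
    then have "tcoord v c' = 0"
      using assms(3) unfolding tangent_space_def mem_Collect_eq by metis
    then show ?thesis
      using False by (auto simp: chart_vector_def)
  qed
  then show ?thesis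
    by (intro tangent.expand ext)
qed

lemma linear_chart_vector:
  assumes "smooth_manifold A" "c \<in> A" "p \<in> fst c"
  shows "linear (chart_vector A c p)"
proof -
  have "linear (frechet_derivative (snd c' \<circ> param c) (at (snd c p)))"
    if "c' \<in> A" "p \<in> fst c'" for c'
    using transition_has_derivative[OF assms(1,2) that(1) assms(3) that(2)]
    by (rule has_derivative_linear)
  then show ?thesis
    by (intro linearI)
      (auto simp: chart_vector_def plus_tangent_def scaleR_tangent_def fun_eq_iff
        linear_add linear_scale)
qed

text \<open>With linearity of \<open>chart_vector\<close>, this makes the tangent space a linear
  image of the coordinate space, hence a subspace with a finite spanning set.\<close>

lemma tangent_space_eq:
  assumes "smooth_manifold A" "c \<in> A" "p \<in> fst c"
  shows "tangent_space A p = range (chart_vector A c p)"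
proof (intro subset_antisym subsetI)
  fix v assume "v \<in> tangent_space A p"
  then show "v \<in> range (chart_vector A c p)"
    using chart_vector_tcoord[OF assms(2,3)] by (metis rangeI)
qed (use chart_vector_in_tangent_space[OF assms] in auto)

lemma smooth_manifold_obtain_chart:
  assumes "smooth_manifold A"
  obtains c where "c \<in> A" "p \<in> fst c"
  using assms unfolding smooth_manifold_def by blast

lemma riemannian_subspace_inner_product:
  assumes "riemannian_manifold A G"
  shows "subspace_inner_product (tangent_space A p) (G p)"
proof
  have A: "smooth_manifold A" and G: "inner_product_on (tangent_space A p) (G p)"
    using assms unfolding riemannian_manifold_def by blast+
  show "inner_product_on (tangent_space A p) (G p)" by (rule G)
  obtain c where c: "c \<in> A" "p \<in> fst c"
    using A by (rule smooth_manifold_obtain_chart)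
  show "subspace (tangent_space A p)"
    unfolding tangent_space_eq[OF A c]
    by (rule linear_subspace_image[OF linear_chart_vector[OF A c] subspace_UNIV])
qed

text \<open>\<open>grad\<close> is a definite description, so a unique representer must be exhibited
  first. Existence comes from \<open>Riesz_span\<close> on the images of a finite spanning set,
  uniqueness from positive definiteness, and agreement between charts from the chain rule. A
  derivative at the single point \<open>p\<close> in one chart suffices, which also covers the
  augmented Lagrangian with its squared maxima.\<close>

lemma grad_of_has_derivative:
  assumes "riemannian_manifold A G" "c \<in> A" "p \<in> fst c"
    and D: "((F \<circ> param c) has_derivative D) (at (snd c p))"
  shows "grad A G F p \<in> tangent_space A p"
    and "v \<in> tangent_space A p \<Longrightarrow> G p (grad A G F p) v = D (tcoord v c)"
proof -
  let ?T = "tangent_space A p"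
  have A: "smooth_manifold A"
    using assms(1) unfolding riemannian_manifold_def by blast
  interpret subspace_inner_product ?T "G p"
    using assms(1) by (rule riemannian_subspace_inner_product)
  obtain B :: "'b set" where B: "finite B" "span B = UNIV"
    using A unfolding smooth_manifold_def by blast
  have T: "?T = span (chart_vector A c p ` B)"
    unfolding tangent_space_eq[OF A assms(2,3)]
      linear_span_image[OF linear_chart_vector[OF A assms(2,3)]] B(2) ..
  have lin: "linear D"
    using D by (rule has_derivative_linear)
  have "\<exists>w\<in>?T. \<forall>v\<in>?T. G p w v = D (tcoord v c)"
  proof -
    have "chart_vector A c p ` B \<subseteq> ?T"
      unfolding T by (rule span_superset)
    then have "\<exists>w\<in>span (chart_vector A c p ` B). \<forall>v\<in>span (chart_vector A c p ` B). G p w v = D (tcoord v c)"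
      using B(1) lin
      by (intro Riesz_span)
        (simp_all add: plus_tangent_def scaleR_tangent_def linear_add linear_scale)
    then show ?thesis
      unfolding T .
  qed
  moreover have *: "D (tcoord v c) = frechet_derivative (F \<circ> param c') (at (snd c' p)) (tcoord v c')"
    if "v \<in> ?T" "c' \<in> A" "p \<in> fst c'" for v c'
  proof -
    have "tcoord v c = frechet_derivative (snd c \<circ> param c') (at (snd c' p)) (tcoord v c')"
      using that(1) that(2,3) assms(2,3) unfolding tangent_space_def mem_Collect_eq
      by (metis IntI)
    then show ?thesis
      using frechet_derivative_at[OF has_derivative_change_chart[OF A assms(2) that(2) assms(3) that(3) D]]
      by (simp add: fun_eq_iff)
  qed
  ultimately obtain w where w: "w \<in> ?T" "\<And>v. v \<in> ?T \<Longrightarrow> G p w v = D (tcoord v c)"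
    by blast
  have "grad A G F p = w"
    unfolding grad_def
  proof (rule the_equality)
    show "w \<in> ?T \<and> (\<forall>v\<in>?T. \<forall>c\<in>A. p \<in> fst c \<longrightarrow>
        G p w v = frechet_derivative (F \<circ> param c) (at (snd c p)) (tcoord v c))"
      using w(1) w(2) *[symmetric] by simp
    fix w' assume w': "w' \<in> ?T \<and> (\<forall>v\<in>?T. \<forall>c\<in>A. p \<in> fst c \<longrightarrow>
        G p w' v = frechet_derivative (F \<circ> param c) (at (snd c p)) (tcoord v c))"
    then have "G p w' v = G p w v" if "v \<in> ?T" for v
      using w' that assms(2,3) w(2)[OF that] *[OF that assms(2,3)] by simp
    then show "w' = w"
      using w' w(1) by (intro eq_if_ip_eq) auto
  qed
  then show "grad A G F p \<in> ?T" "v \<in> ?T \<Longrightarrow> G p (grad A G F p) v = D (tcoord v c)"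
    using w by auto
qed

text \<open>Continuity of the directional derivatives is read off from the second level of
  \<open>Ck_on\<close>, which makes them differentiable.\<close>

lemma Ck_function_2_chart:
  fixes A :: "('a::{t2_space, second_countable_topology}, 'e::real_normed_vector) chart set"
  assumes "Ck_function A 2 F" "c \<in> A" "p \<in> fst c"
  shows "((F \<circ> param c) has_derivative frechet_derivative (F \<circ> param c) (at (snd c p))) (at (snd c p))"
    and "((\<lambda>y. frechet_derivative (F \<circ> param c) (at y) u) \<longlongrightarrow>
      frechet_derivative (F \<circ> param c) (at (snd c p)) u) (nhds (snd c p))"
proof -
  have Ck: "Ck_on (Suc (Suc 0)) (snd c ` fst c) (F \<circ> param c)"
    using assms(1,2) unfolding Ck_function_def by (simp only: numeral_2_eq_2)
  then show "((F \<circ> param c) has_derivative frechet_derivative (F \<circ> param c) (at (snd c p))) (at (snd c p))"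
    using assms(3) by (simp add: frechet_derivative_works)
  have "(\<lambda>y. frechet_derivative (F \<circ> param c) (at y) u) differentiable (at (snd c p))"
    using Ck assms(3) by simp
  then have "isCont (\<lambda>y. frechet_derivative (F \<circ> param c) (at y) u) (snd c p)"
    by (rule differentiable_imp_continuous_within)
  then show "((\<lambda>y. frechet_derivative (F \<circ> param c) (at y) u) \<longlongrightarrow>
      frechet_derivative (F \<circ> param c) (at (snd c p)) u) (nhds (snd c p))"
    using tendsto_at_iff_tendsto_nhds[of "\<lambda>y. frechet_derivative (F \<circ> param c) (at y) u" "snd c p"]
    unfolding continuous_at by simp
qed

lemma Ck_function_2_tendsto:
  fixes A :: "('a::{t2_space, second_countable_topology}, 'e::real_normed_vector) chart set"
  assumes A: "smooth_manifold A" and F: "Ck_function A 2 F"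
  shows "(F \<longlongrightarrow> F p) (nhds p)"
proof -
  obtain c where c: "c \<in> A" "p \<in> fst c"
    using A by (rule smooth_manifold_obtain_chart)
  note chart = is_chartD[OF smooth_manifold_chart[OF A c(1)]]
  have "isCont (F \<circ> param c) (snd c p)"
    using Ck_function_2_chart(1)[OF F c] by (rule has_derivative_continuous)
  then have "((F \<circ> param c) \<longlongrightarrow> F p) (nhds (snd c p))"
    using tendsto_at_iff_tendsto_nhds[of "F \<circ> param c" "snd c p"] chart(1)[OF c(2)]
    unfolding continuous_at by simp
  then have "((\<lambda>y. (F \<circ> param c) (snd c y)) \<longlongrightarrow> F p) (nhds p)"
    by (rule filterlim_compose[OF _ chart(3)[OF c(2)]])
  moreover have "open (fst c)"
    using smooth_manifold_chart[OF A c(1)] unfolding is_chart_def by blast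
  then have "eventually (\<lambda>y. y \<in> fst c) (nhds p)"
    using c(2) by (rule eventually_nhds_in_open)
  then have "eventually (\<lambda>y. (F \<circ> param c) (snd c y) = F y) (nhds p)"
    by eventually_elim (simp add: chart(1))
  ultimately show ?thesis
    by (rule Lim_transform_eventually)
qed

text \<open>\<open>D k u\<close> is the inner product at \<open>z k\<close> of the gradient with the
  vector of coordinates \<open>u\<close>. By Cauchy-Schwarz it is at most \<open>e k\<close> times
  the length of that vector, and this length converges. Tangent spaces at different points are
  compared only through the coordinates in \<open>c\<close>.\<close>

lemma approximate_stationarity_limit:
  fixes A :: "('a::{t2_space, second_countable_topology}, 'e::real_normed_vector) chart set"
  assumes riem: "riemannian_manifold A G" and c: "c \<in> A" "p \<in> fst c"
    and z: "z \<longlonglongrightarrow> p"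
    and D: "eventually (\<lambda>k. ((F k \<circ> param c) has_derivative D k) (at (snd c (z k)))) sequentially"
    and le: "eventually (\<lambda>k. tnorm G (z k) (grad A G (F k) (z k)) \<le> e k) sequentially"
    and e: "e \<longlonglongrightarrow> 0"
  shows "(\<lambda>k. D k u) \<longlonglongrightarrow> 0"
proof -
  have A: "smooth_manifold A"
    using riem unfolding riemannian_manifold_def by blast
  note chart = is_chartD[OF smooth_manifold_chart[OF A c(1)]]
  define V where "V k = chart_vector A c (z k) u" for k
  \<comment> \<open>The squared length of the vector with constant coordinates \<open>u\<close>, as
    a function of the coordinates of its base point; smoothness of the metric makes it
    continuous.\<close>
  define H where "H y = G (param c y) (chart_vector A c (param c y) u) (chart_vector A c (param c y) u)" for y
  have oc: "open (fst c)" "open (snd c ` fst c)"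
    using smooth_manifold_chart[OF A c(1)] unfolding is_chart_def by blast+
  have zc: "eventually (\<lambda>k. z k \<in> fst c) sequentially"
    using z oc(1) c(2) by (rule topological_tendstoD)
  have "smooth_on (snd c ` fst c) H"
    using riem c(1) unfolding riemannian_manifold_def H_def by blast
  then have "continuous_on (snd c ` fst c) H"
    unfolding smooth_on_def by (metis Ck_on.simps(1))
  then have "isCont H (snd c p)"
    using oc(2) c(2) by (simp add: continuous_on_eq_continuous_at)
  moreover have "(\<lambda>k. snd c (z k)) \<longlonglongrightarrow> snd c p"
    using chart(3)[OF c(2)] z by (rule filterlim_compose)
  ultimately have "(\<lambda>k. H (snd c (z k))) \<longlonglongrightarrow> H (snd c p)"
    by (rule isCont_tendsto_compose)
  then have "(\<lambda>k. e k * sqrt (H (snd c (z k)))) \<longlonglongrightarrow> 0 * sqrt (H (snd c p))"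
    using e by (intro tendsto_intros)
  then have lim: "(\<lambda>k. e k * sqrt (H (snd c (z k)))) \<longlonglongrightarrow> 0"
    by simp
  have "eventually (\<lambda>k. norm (D k u) \<le> e k * sqrt (H (snd c (z k)))) sequentially"
    using zc D le
  proof eventually_elim
    case (elim k)
    interpret T: subspace_inner_product "tangent_space A (z k)" "G (z k)"
      using riem by (rule riemannian_subspace_inner_product)
    have V: "V k \<in> tangent_space A (z k)" "tcoord (V k) c = u"
      unfolding V_def using A c(1) elim(1)
      by (rule chart_vector_in_tangent_space, rule tcoord_chart_vector)
    note grad = grad_of_has_derivative[OF riem c(1) elim(1,2)]
    have "D k u = G (z k) (grad A G (F k) (z k)) (V k)"
      using grad(2)[OF V(1)] V(2) by simp
    then have "norm (D k u) \<le> tnorm G (z k) (grad A G (F k) (z k)) * sqrt (G (z k) (V k) (V k))"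
      using T.Cauchy_Schwarz[OF grad(1) V(1)] unfolding tnorm_def by simp
    also have "\<dots> \<le> e k * sqrt (G (z k) (V k) (V k))"
      using elim(3) T.ip_nonneg[OF V(1)] by (intro mult_right_mono) simp_all
    finally show ?case
      using chart(1)[OF elim(1)] unfolding H_def V_def by simp
  qed
  then show ?thesis
    using lim by (rule Lim_null_comparison)
qed

section \<open>Multipliers\<close>

text \<open>With \<open>E\<close> the deviation of \<open>M\<close> from the identity,
  \<open>r k t\<close> is \<open>c k t\<close> plus a perturbation of size at most
  \<open>C k * e k\<close>. This first bounds the sum \<open>C k\<close> of the absolute values of
  the unknowns in terms of \<open>R k\<close>, and then shows that the perturbation vanishes.
  Boundedness of \<open>c\<close> is thus a consequence rather than an assumption.\<close>

lemma solution_tendsto_of_matrix_tendsto_identity: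
  fixes c :: "nat \<Rightarrow> 's \<Rightarrow> real" and M :: "nat \<Rightarrow> 's \<Rightarrow> 's \<Rightarrow> real"
  assumes S: "finite S"
    and M: "\<And>s t. s \<in> S \<Longrightarrow> t \<in> S \<Longrightarrow> (\<lambda>k. M k s t) \<longlonglongrightarrow> (if s = t then 1 else 0)"
    and r: "\<And>t. t \<in> S \<Longrightarrow> (\<lambda>k. \<Sum>s\<in>S. c k s * M k s t) \<longlonglongrightarrow> \<beta> t"
    and t: "t \<in> S"
  shows "(\<lambda>k. c k t) \<longlonglongrightarrow> \<beta> t"
proof -
  define r where "r k t = (\<Sum>s\<in>S. c k s * M k s t)" for k t
  define E where "E k s t = M k s t - (if s = t then 1 else 0)" for k s t
  define e where "e k = (\<Sum>s\<in>S. \<Sum>t\<in>S. \<bar>E k s t\<bar>)" for k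
  define C where "C k = (\<Sum>s\<in>S. \<bar>c k s\<bar>)" for k
  define R where "R k = (\<Sum>t\<in>S. \<bar>r k t\<bar>)" for k
  have "(\<lambda>k. \<bar>E k s t\<bar>) \<longlonglongrightarrow> \<bar>0\<bar>" if "s \<in> S" "t \<in> S" for s t
    unfolding E_def by (intro tendsto_rabs LIM_zero M that)
  then have "e \<longlonglongrightarrow> (\<Sum>s\<in>S. \<Sum>t\<in>S. \<bar>0\<bar>)"
    unfolding e_def by (intro tendsto_sum)
  then have e: "e \<longlonglongrightarrow> 0"
    by simp
  have R: "R \<longlonglongrightarrow> (\<Sum>t\<in>S. \<bar>\<beta> t\<bar>)"
    unfolding R_def r_def by (intro tendsto_sum tendsto_rabs r)
  have expand: "r k t = c k t + (\<Sum>s\<in>S. c k s * E k s t)" if "t \<in> S" for k t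
  proof -
    have "(\<Sum>s\<in>S. c k s * E k s t) = (\<Sum>s\<in>S. c k s * M k s t - (if s = t then c k s else 0))"
      by (intro sum.cong) (auto simp: E_def algebra_simps)
    also have "\<dots> = r k t - c k t"
      using S that by (simp add: sum_subtractf r_def)
    finally show ?thesis
      by simp
  qed
  have row: "(\<Sum>t\<in>S. \<bar>E k s t\<bar>) \<le> e k" if "s \<in> S" for k s
    unfolding e_def using S that by (intro member_le_sum[of s S "\<lambda>s. \<Sum>t\<in>S. \<bar>E k s t\<bar>"]) (auto intro: sum_nonneg)
  have entry: "\<bar>E k s t\<bar> \<le> e k" if "s \<in> S" "t \<in> S" for k s t
    using S that row[OF that(1), of k] member_le_sum[of t S "\<lambda>t. \<bar>E k s t\<bar>"] by fastforce
  have diff: "\<bar>\<Sum>s\<in>S. c k s * E k s t\<bar> \<le> C k * e k" if "t \<in> S" for k t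
    unfolding C_def sum_distrib_right
    by (rule order_trans[OF sum_abs])
      (auto simp: abs_mult intro!: sum_mono mult_left_mono entry that)
  have CR: "C k \<le> R k + C k * e k" for k
  proof -
    have "C k \<le> (\<Sum>t\<in>S. \<bar>r k t\<bar> + (\<Sum>s\<in>S. \<bar>c k s\<bar> * \<bar>E k s t\<bar>))"
      unfolding C_def
    proof (rule sum_mono)
      fix t assume "t \<in> S"
      have "\<bar>\<Sum>s\<in>S. c k s * E k s t\<bar> \<le> (\<Sum>s\<in>S. \<bar>c k s\<bar> * \<bar>E k s t\<bar>)"
        using sum_abs[of "\<lambda>s. c k s * E k s t" S] by (simp add: abs_mult)
      then show "\<bar>c k t\<bar> \<le> \<bar>r k t\<bar> + (\<Sum>s\<in>S. \<bar>c k s\<bar> * \<bar>E k s t\<bar>)"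
        using expand[OF \<open>t \<in> S\<close>, of k] by linarith
    qed
    also have "\<dots> = R k + (\<Sum>s\<in>S. \<bar>c k s\<bar> * (\<Sum>t\<in>S. \<bar>E k s t\<bar>))"
      unfolding R_def sum.distrib sum_distrib_left
      using sum.swap[of "\<lambda>t s. \<bar>c k s\<bar> * \<bar>E k s t\<bar>" S S] by simp
    also have "(\<Sum>s\<in>S. \<bar>c k s\<bar> * (\<Sum>t\<in>S. \<bar>E k s t\<bar>)) \<le> C k * e k"
      unfolding C_def sum_distrib_right
      by (intro sum_mono mult_left_mono row) auto
    finally show ?thesis
      by simp
  qed
  have C0: "C k \<ge> 0" "e k \<ge> 0" for k
    unfolding C_def e_def by (auto intro!: sum_nonneg)
  \<comment> \<open>Below 1/2 the term \<open>C k * e k\<close> in \<open>CR\<close> can be absorbed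
    into the left-hand side, giving \<open>C k \<le> 2 * R k\<close>.\<close>
  have "eventually (\<lambda>k. e k < 1/2) sequentially"
    using e by (rule order_tendstoD) simp
  then have "eventually (\<lambda>k. C k * e k \<le> 2 * R k * e k) sequentially"
  proof eventually_elim
    case (elim k)
    then have "C k * e k \<le> C k * (1/2)"
      using C0(1)[of k] by (intro mult_left_mono) auto
    then have "C k \<le> 2 * R k"
      using CR[of k] by linarith
    then show ?case
      using C0(2) by (intro mult_right_mono)
  qed
  then have "eventually (\<lambda>k. norm (c k t - r k t) \<le> 2 * R k * e k) sequentially"
  proof eventually_elim
    case (elim k)
    then show ?case
      using diff[OF t, of k] expand[OF t, of k] by simp
  qed
  moreover have "(\<lambda>k. 2 * R k * e k) \<longlonglongrightarrow> 2 * (\<Sum>t\<in>S. \<bar>\<beta> t\<bar>) * 0"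
    using R e by (intro tendsto_intros)
  then have "(\<lambda>k. 2 * R k * e k) \<longlonglongrightarrow> 0"
    by simp
  ultimately have "(\<lambda>k. c k t - r k t) \<longlonglongrightarrow> 0"
    by (rule Lim_null_comparison)
  then have "(\<lambda>k. (c k t - r k t) + r k t) \<longlonglongrightarrow> 0 + \<beta> t"
    unfolding r_def using r[OF t] by (rule tendsto_add)
  then show ?thesis
    by simp
qed

section \<open>The augmented Lagrangian method\<close>

text \<open>The error of the linear approximation is at most \<open>d\<^sup>2\<close> whatever the
  signs of \<open>t\<close> and \<open>t + d\<close>, so squaring removes the kink at 0.\<close>

lemma DERIV_max_0_squared: "((\<lambda>s::real. (max 0 s)\<^sup>2) has_real_derivative 2 * max 0 t) (at t)"
proof -
  have bound: "\<bar>(max 0 (t + d))\<^sup>2 - (max 0 t)\<^sup>2 - 2 * max 0 t * d\<bar> \<le> d\<^sup>2" for d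
  proof -
    consider "t \<ge> 0" "t + d \<ge> 0" | "t \<ge> 0" "t + d < 0" | "t < 0" "t + d \<ge> 0" | "t < 0" "t + d < 0"
      by linarith
    then show ?thesis
    proof cases
      case 2
      \<comment> \<open>\<open>b\<close> measures how far \<open>t + d\<close> falls below 0;
        \<open>d\<^sup>2\<close> exceeds the error by exactly \<open>b\<^sup>2\<close>.\<close>
      define b where "b = - (t + d)"
      have d: "d = - (t + b)" "b > 0"
        using 2 by (auto simp: b_def)
      have "(max 0 (t + d))\<^sup>2 - (max 0 t)\<^sup>2 - 2 * max 0 t * d = - t\<^sup>2 - 2 * t * d"
        using 2 by simp
      also have "\<dots> = t\<^sup>2 + 2 * t * b"
        unfolding d(1) by (simp add: power2_eq_square algebra_simps)
      finally have eq: "(max 0 (t + d))\<^sup>2 - (max 0 t)\<^sup>2 - 2 * max 0 t * d = t\<^sup>2 + 2 * t * b" .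
      have "d\<^sup>2 = t\<^sup>2 + 2 * t * b + b\<^sup>2"
        unfolding d(1) by (simp add: power2_eq_square algebra_simps)
      then show ?thesis
        unfolding eq using 2(1) d(2) by simp
    next
      case 3
      then have "(t + d)\<^sup>2 \<le> d\<^sup>2"
        by (intro power_mono) auto
      then show ?thesis
        using 3 by simp
    qed (simp_all add: power2_eq_square algebra_simps)
  qed
  have "norm (((max 0 (t + d))\<^sup>2 - (max 0 t)\<^sup>2) / d - 2 * max 0 t) \<le> \<bar>d\<bar>" if "d \<noteq> 0" for d
  proof -
    have "((max 0 (t + d))\<^sup>2 - (max 0 t)\<^sup>2) / d - 2 * max 0 t
        = ((max 0 (t + d))\<^sup>2 - (max 0 t)\<^sup>2 - 2 * max 0 t * d) / d"
      using that by (simp add: diff_divide_distrib)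
    then have "norm (((max 0 (t + d))\<^sup>2 - (max 0 t)\<^sup>2) / d - 2 * max 0 t) \<le> d\<^sup>2 / \<bar>d\<bar>"
      using bound[of d] by (simp only: real_norm_def abs_divide divide_right_mono abs_ge_zero)
    also have "\<dots> = \<bar>d\<bar>"
      using that by (simp add: power2_eq_square divide_simps)
    finally show ?thesis .
  qed
  then have "eventually (\<lambda>d. norm (((max 0 (t + d))\<^sup>2 - (max 0 t)\<^sup>2) / d - 2 * max 0 t) \<le> \<bar>d\<bar>) (at 0)"
    by (auto simp: eventually_at_filter)
  moreover have "((\<lambda>d. \<bar>d\<bar>) \<longlongrightarrow> 0) (at (0::real))"
    by (intro tendsto_eq_intros) auto
  ultimately have "((\<lambda>d. ((max 0 (t + d))\<^sup>2 - (max 0 t)\<^sup>2) / d - 2 * max 0 t) \<longlongrightarrow> 0) (at 0)"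
    by (rule Lim_null_comparison)
  then show ?thesis
    unfolding DERIV_def by (rule LIM_zero_cancel)
qed

text \<open>The factor \<open>\<rho> / 2\<close> cancels the 2 from each square, and
  \<open>\<rho> > 0\<close> can be moved inside the maximum. The coefficients thereby become the
  multiplier updates before clipping, cut off at 0 for the inequality constraints.\<close>

lemma has_derivative_aug_lagrangian:
  assumes rho: "\<rho> > 0"
    and f: "((f \<circ> \<phi>) has_derivative Df) (at y)"
    and g: "\<And>i. i \<in> {1..n} \<Longrightarrow> ((g i \<circ> \<phi>) has_derivative Dg i) (at y)"
    and h: "\<And>j. j \<in> {n+1..n+m} \<Longrightarrow> ((h j \<circ> \<phi>) has_derivative Dh j) (at y)"
  shows "(((\<lambda>z. aug_lagrangian n m f g h \<rho> z lam gam) \<circ> \<phi>) has_derivative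
    (\<lambda>u. Df u + ((\<Sum>i\<in>{1..n}. max 0 (lam i + \<rho> * g i (\<phi> y)) * Dg i u)
      + (\<Sum>j\<in>{n+1..n+m}. (gam j + \<rho> * h j (\<phi> y)) * Dh j u)))) (at y)"
proof -
  have G: "((\<lambda>z. (max 0 (lam i / \<rho> + (g i \<circ> \<phi>) z))\<^sup>2) has_derivative
      (\<lambda>u. 2 * max 0 (lam i / \<rho> + (g i \<circ> \<phi>) y) * Dg i u)) (at y)" if "i \<in> {1..n}" for i
  proof -
    have "((\<lambda>z. lam i / \<rho> + (g i \<circ> \<phi>) z) has_derivative Dg i) (at y)"
      using has_derivative_add[OF has_derivative_const g[OF that]] by simp
    then show ?thesis
      by (rule has_derivative_compose)
        (use DERIV_max_0_squared in \<open>simp add: has_field_derivative_def\<close>)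
  qed
  have H: "((\<lambda>z. ((h j \<circ> \<phi>) z + gam j / \<rho>)\<^sup>2) has_derivative
      (\<lambda>u. 2 * ((h j \<circ> \<phi>) y + gam j / \<rho>) * Dh j u)) (at y)" if "j \<in> {n+1..n+m}" for j
    by (rule derivative_eq_intros h that refl)+ (simp add: fun_eq_iff algebra_simps)
  have "((\<lambda>z. (f \<circ> \<phi>) z + \<rho> / 2 * ((\<Sum>j\<in>{n+1..n+m}. ((h j \<circ> \<phi>) z + gam j / \<rho>)\<^sup>2)
        + (\<Sum>i\<in>{1..n}. (max 0 (lam i / \<rho> + (g i \<circ> \<phi>) z))\<^sup>2))) has_derivative
      (\<lambda>u. Df u + \<rho> / 2 * ((\<Sum>j\<in>{n+1..n+m}. 2 * ((h j \<circ> \<phi>) y + gam j / \<rho>) * Dh j u)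
        + (\<Sum>i\<in>{1..n}. 2 * max 0 (lam i / \<rho> + (g i \<circ> \<phi>) y) * Dg i u)))) (at y)"
    by (intro has_derivative_add f has_derivative_mult_right has_derivative_sum G H)
  moreover have Ai: "\<rho> / 2 * (2 * max 0 (lam i / \<rho> + t) * a) = max 0 (lam i + \<rho> * t) * a" for i t a
  proof -
    have "\<rho> * max 0 (lam i / \<rho> + t) = max (\<rho> * 0) (\<rho> * (lam i / \<rho> + t))"
      using rho by (simp add: max_mult_distrib_left)
    then show ?thesis
      using rho by (simp add: distrib_left)
  qed
  have Ej: "\<rho> / 2 * (2 * (t + gam j / \<rho>) * a) = (gam j + \<rho> * t) * a" for j t a
    using rho by (simp add: field_simps)
  have "(\<lambda>u. Df u + \<rho> / 2 * ((\<Sum>j\<in>{n+1..n+m}. 2 * ((h j \<circ> \<phi>) y + gam j / \<rho>) * Dh j u)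
        + (\<Sum>i\<in>{1..n}. 2 * max 0 (lam i / \<rho> + (g i \<circ> \<phi>) y) * Dg i u)))
    = (\<lambda>u. Df u + ((\<Sum>i\<in>{1..n}. max 0 (lam i + \<rho> * g i (\<phi> y)) * Dg i u)
      + (\<Sum>j\<in>{n+1..n+m}. (gam j + \<rho> * h j (\<phi> y)) * Dh j u)))"
    unfolding distrib_left[of "\<rho> / 2"] sum_distrib_left Ai Ej comp_def by (simp only: add.commute)
  ultimately show ?thesis
    by (simp only: aug_lagrangian_def comp_def)
qed

text \<open>\<open>rho\<close> is nondecreasing. If it is bounded, it converges to some
  \<open>L > 0\<close>, and close enough to \<open>L\<close> one more multiplication by
  \<open>th_rho\<close> would overshoot. From then on every step passes the test on the residual,
  which contracts geometrically.\<close>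

lemma penalty_unbounded_or_residual_vanishes:
  fixes rho R :: "nat \<Rightarrow> real"
  assumes "rho 0 > 0" "th_rho > 1" "0 < th_sig" "th_sig < 1" "\<And>k. R k \<ge> 0"
    and step: "\<And>k. rho (Suc k) = (if k = 0 \<or> R (Suc k) \<le> th_sig * R k then rho k else th_rho * rho k)"
  shows "(\<forall>k. rho k > 0) \<and> (filterlim rho at_top sequentially \<or> R \<longlonglongrightarrow> 0)"
proof
  show pos: "\<forall>k. rho k > 0"
  proof
    show "rho k > 0" for k
      using assms(1,2) by (induction k) (auto simp: step)
  qed
  have inc: "incseq rho"
    using pos assms(2) by (intro incseq_SucI) (auto simp: step less_imp_le)
  show "filterlim rho at_top sequentially \<or> R \<longlonglongrightarrow> 0"
  proof (cases "\<exists>B. \<forall>k. rho k \<le> B")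
    case False
    have "filterlim rho at_top sequentially"
      unfolding filterlim_at_top
    proof
      fix B
      obtain N where "B < rho N"
        using False by (meson not_le)
      then show "eventually (\<lambda>k. B \<le> rho k) sequentially"
        using incseqD[OF inc] by (intro eventually_sequentiallyI[of N]) fastforce
    qed
    then show ?thesis ..
  next
    case True
    then obtain B where "\<forall>k. rho k \<le> B" ..
    then obtain L where L: "rho \<longlonglongrightarrow> L" "\<forall>k. rho k \<le> L"
      using incseq_convergent[OF inc] by blast
    have "L > 0"
      using assms(1) L(2) by (meson less_le_trans)
    then have "L / th_rho < L"
      using assms(2) by (simp add: field_simps)
    then have "eventually (\<lambda>k. L / th_rho < rho k) sequentially"
      using L(1) by (simp add: order_tendstoD)
    then obtain N where N: "\<And>k. k \<ge> N \<Longrightarrow> L / th_rho < rho k"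
      unfolding eventually_sequentially by blast
    \<comment> \<open>Starting at \<open>Suc N\<close> excludes \<open>k = 0\<close>, where
      \<open>rho\<close> is kept whatever the residual does.\<close>
    have contract: "R (Suc k) \<le> th_sig * R k" if "k \<ge> Suc N" for k
    proof (rule ccontr)
      assume "\<not> ?thesis"
      then have "rho (Suc k) = th_rho * rho k"
        using that by (simp add: step)
      moreover have "L < th_rho * rho k"
        using N[of k] that assms(2) by (simp add: field_simps)
      ultimately show False
        using L(2) by (metis not_le)
    qed
    have geo: "R (k + Suc N) \<le> th_sig ^ k * R (Suc N)" for k
    proof (induction k)
      case (Suc k)
      have "R (Suc k + Suc N) \<le> th_sig * R (k + Suc N)"
        using contract[of "k + Suc N"] by simp
      also have "\<dots> \<le> th_sig * (th_sig ^ k * R (Suc N))"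
        using Suc assms(3) by (intro mult_left_mono) auto
      finally show ?case
        by (simp add: mult.assoc)
    qed simp
    have "(\<lambda>k. th_sig ^ k * R (Suc N)) \<longlonglongrightarrow> 0 * R (Suc N)"
      using assms(3,4) by (intro tendsto_mult LIMSEQ_realpow_zero tendsto_const) auto
    then have "(\<lambda>k. th_sig ^ k * R (Suc N)) \<longlonglongrightarrow> 0"
      by simp
    then have "(\<lambda>k. R (k + Suc N)) \<longlonglongrightarrow> 0"
      by (rule Lim_null_comparison[rotated]) (use geo assms(5) in simp)
    then have "R \<longlonglongrightarrow> 0"
      by (rule LIMSEQ_offset)
    then show ?thesis ..
  qed
qed

text \<open>Only later multipliers are clipped, so the upper bound has to include the initial
  value.\<close>

lemma multiplier_ralm_bounds:
  assumes "infinite_ralm_run A G n m g h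
      eps_min th_eps th_rho th_sig lam_max gam_min gam_max d_min x lam gam sig eps rho"
    and "ralm_inputs n m (lam 0) eps_min (eps 0) (rho 0) th_eps th_rho th_sig lam_max gam_min gam_max"
    and "i \<in> {1..n}"
  shows "0 \<le> lam k i \<and> lam k i \<le> max (lam 0 i) (lam_max i)"
proof (cases k)
  case 0
  then show ?thesis
    using assms(2,3) unfolding ralm_inputs_def by simp
next
  case (Suc k')
  have "lam (Suc k') i = clip 0 (lam_max i) (lam k' i + rho k' * g i (x (Suc k')))"
    using assms(1,3) unfolding infinite_ralm_run_def by blast
  moreover have "lam_max i \<ge> 0"
    using assms(2,3) unfolding ralm_inputs_def by blast
  ultimately show ?thesis
    unfolding Suc clip_def by auto
qed

text \<open>With minimal tolerance 0 the maximum in the update always selects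
  \<open>th_eps * eps k\<close>, so the tolerances form a geometric sequence.\<close>

lemma tolerance_ralm_tendsto_zero:
  assumes "infinite_ralm_run A G n m g h
      0 th_eps th_rho th_sig lam_max gam_min gam_max d_min x lam gam sig eps rho"
    and "ralm_inputs n m (lam 0) 0 (eps 0) (rho 0) th_eps th_rho th_sig lam_max gam_min gam_max"
  shows "eps \<longlonglongrightarrow> 0"
proof -
  have th: "0 < th_eps" "th_eps < 1" "eps 0 > 0"
    using assms(2) unfolding ralm_inputs_def by blast+
  have step: "eps (Suc k) = max 0 (th_eps * eps k)" for k
    using assms(1) unfolding infinite_ralm_run_def by blast
  have "eps = (\<lambda>k. th_eps ^ k * eps 0)"
  proof
    fix k show "eps k = th_eps ^ k * eps 0"
      using th by (induction k) (simp_all add: step mult.assoc)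
  qed
  moreover have "(\<lambda>k. th_eps ^ k * eps 0) \<longlonglongrightarrow> 0 * eps 0"
    using th by (intro tendsto_mult LIMSEQ_realpow_zero tendsto_const) auto
  ultimately show ?thesis
    by simp
qed

lemma residual_bounds:
  shows "0 \<le> residual n m h x s" and "i \<in> {1..n} \<Longrightarrow> \<bar>s i\<bar> \<le> residual n m h x s"
  unfolding residual_def by (rule Max_ge, simp, blast)+

lemma penalty_ralm:
  assumes "infinite_ralm_run A G n m g h
      eps_min th_eps th_rho th_sig lam_max gam_min gam_max d_min x lam gam sig eps rho"
    and "ralm_inputs n m (lam 0) eps_min (eps 0) (rho 0) th_eps th_rho th_sig lam_max gam_min gam_max"
  shows "\<forall>k. rho k > 0"
    and "filterlim rho at_top sequentially \<or> (\<lambda>k. residual n m h (x k) (sig k)) \<longlonglongrightarrow> 0"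
proof -
  have "rho 0 > 0" "th_rho > 1" "0 < th_sig" "th_sig < 1"
    using assms(2) unfolding ralm_inputs_def by blast+
  moreover have "rho (Suc k) =
      (if k = 0 \<or> residual n m h (x (Suc k)) (sig (Suc k)) \<le> th_sig * residual n m h (x k) (sig k)
       then rho k else th_rho * rho k)" for k
    using assms(1) unfolding infinite_ralm_run_def by blast
  ultimately have "(\<forall>k. rho k > 0) \<and>
      (filterlim rho at_top sequentially \<or> (\<lambda>k. residual n m h (x k) (sig k)) \<longlonglongrightarrow> 0)"
    using residual_bounds(1) by (intro penalty_unbounded_or_residual_vanishes)
  then show "\<forall>k. rho k > 0"
    and "filterlim rho at_top sequentially \<or> (\<lambda>k. residual n m h (x k) (sig k)) \<longlonglongrightarrow> 0"
    by blast+
qed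

text \<open>Eventually \<open>g i\<close> is below \<open>a / 2\<close>, so it suffices that
  \<open>lam\<close> is at most \<open>rho * (- (a / 2))\<close>. If \<open>rho\<close> tends to
  infinity, this follows from boundedness of \<open>lam\<close>; otherwise the vanishing residual
  forces \<open>lam / rho\<close> to be small.\<close>

lemma inactive_multiplier_ralm_vanishes:
  assumes run: "infinite_ralm_run A G n m g h
      eps_min th_eps th_rho th_sig lam_max gam_min gam_max d_min x lam gam sig eps rho"
    and inputs: "ralm_inputs n m (lam 0) eps_min (eps 0) (rho 0) th_eps th_rho th_sig
      lam_max gam_min gam_max"
    and i: "i \<in> {1..n}" and q: "filterlim q at_top sequentially"
    and lim: "(\<lambda>k. g i (x (Suc (q k)))) \<longlonglongrightarrow> a" "a < 0"
  shows "eventually (\<lambda>k. max 0 (lam (q k) i + rho (q k) * g i (x (Suc (q k)))) = 0) sequentially"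
proof -
  note pos = penalty_ralm(1)[OF run inputs, rule_format]
  have ga: "eventually (\<lambda>k. g i (x (Suc (q k))) < a / 2) sequentially"
    using lim by (intro order_tendstoD) auto
  consider "filterlim rho at_top sequentially" | "(\<lambda>k. residual n m h (x k) (sig k)) \<longlonglongrightarrow> 0"
    using penalty_ralm(2)[OF run inputs] by blast
  then show ?thesis
  proof cases
    case 1
    define \<Lambda> where "\<Lambda> = max (lam 0 i) (lam_max i)"
    have "eventually (\<lambda>k. \<Lambda> / (- (a / 2)) \<le> rho (q k)) sequentially"
      using filterlim_compose[OF 1 q] unfolding filterlim_at_top by blast
    then show ?thesis
      using ga
    proof eventually_elim
      case (elim k)
      have "\<Lambda> \<le> rho (q k) * (- (a / 2))"
        using elim(1) lim(2) by (simp add: field_simps)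
      moreover have "rho (q k) * g i (x (Suc (q k))) \<le> rho (q k) * (a / 2)"
        using elim(2) pos[of "q k"] by (intro mult_left_mono) auto
      moreover have "lam (q k) i \<le> \<Lambda>"
        using multiplier_ralm_bounds[OF run inputs i] unfolding \<Lambda>_def by blast
      ultimately show ?case
        by simp
    qed
  next
    case 2
    have "eventually (\<lambda>k. residual n m h (x k) (sig k) < - (a / 2)) sequentially"
      using 2 lim(2) by (intro order_tendstoD) auto
    \<comment> \<open>The index is shifted because \<open>sig (Suc (q k))\<close> is the one built
      from \<open>lam (q k)\<close> and \<open>rho (q k)\<close>.\<close>
    moreover have "filterlim (\<lambda>k. Suc (q k)) at_top sequentially"
      using filterlim_compose[OF filterlim_Suc q] .
    ultimately have "eventually (\<lambda>k. residual n m h (x (Suc (q k))) (sig (Suc (q k))) < - (a / 2)) sequentially"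
      by (rule eventually_compose_filterlim)
    then show ?thesis
      using ga
    proof eventually_elim
      case (elim k)
      have "\<bar>sig (Suc (q k)) i\<bar> < - (a / 2)"
        using residual_bounds(2)[OF i] elim(1) by (rule le_less_trans)
      moreover have "sig (Suc (q k)) i = max (g i (x (Suc (q k)))) (- (lam (q k) i / rho (q k)))"
        using run i unfolding infinite_ralm_run_def by blast
      \<comment> \<open>The maximum defining \<open>sig\<close> exceeds \<open>a / 2\<close> while
        \<open>g i\<close> lies below it, so the maximum is attained by
        \<open>- (lam / rho)\<close>.\<close>
      ultimately have "lam (q k) i / rho (q k) < - (a / 2)"
        using elim(2) by linarith
      then have "lam (q k) i < rho (q k) * (- (a / 2))"
        using pos[of "q k"] by (simp add: field_simps)
      moreover have "rho (q k) * g i (x (Suc (q k))) \<le> rho (q k) * (a / 2)"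
        using elim(2) pos[of "q k"] by (intro mult_left_mono) auto
      ultimately show ?case
        by simp
    qed
  qed
qed

theorem proposition3p2:
  fixes A :: "('a::{t2_space, second_countable_topology}, 'e::real_normed_vector) chart set"
    and G :: "('a, 'e) metric"
    and n m :: nat
    and f :: "'a \<Rightarrow> real" and g h :: "nat \<Rightarrow> 'a \<Rightarrow> real"
    and x :: "nat \<Rightarrow> 'a" and xbar :: 'a
    and lam gam sig :: "nat \<Rightarrow> nat \<Rightarrow> real" and eps rho :: "nat \<Rightarrow> real"
    and eps_min th_eps th_rho th_sig d_min :: real
    and lam_max gam_min gam_max :: "nat \<Rightarrow> real"
  assumes manifold: "complete_riemannian_manifold A G"
    and f_C2: "Ck_function A 2 f"
    and g_C2: "\<And>i. i \<in> {1..n} \<Longrightarrow> Ck_function A 2 (g i)"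
    and h_C2: "\<And>j. j \<in> {n+1..n+m} \<Longrightarrow> Ck_function A 2 (h j)"
    and inputs: "ralm_inputs n m (lam 0) eps_min (eps 0) (rho 0) th_eps th_rho th_sig
      lam_max gam_min gam_max"
    and eps_min: "eps_min = 0"
    and run: "infinite_ralm_run A G n m g h eps_min th_eps th_rho th_sig
      lam_max gam_min gam_max d_min x lam gam sig eps rho"
    and subsolver: "\<And>k. tnorm G (x (Suc k))
      (grad A G (\<lambda>z. aug_lagrangian n m f g h (rho k) z (lam k) (gam k)) (x (Suc k))) \<le> eps k"
    and limit_point: "\<exists>r::nat \<Rightarrow> nat. strict_mono r \<and> (x \<circ> r) \<longlonglongrightarrow> xbar"
    and feasible: "xbar \<in> feasible_set n m g h"
    and licq: "LICQ A G n m g h xbar"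
  shows "KKT A G n m f g h xbar"
proof -

  \<comment> \<open>The subsequence and a chart around its limit\<close>
  have riem: "riemannian_manifold A G"
    using manifold unfolding complete_riemannian_manifold_def by blast
  then have A: "smooth_manifold A"
    unfolding riemannian_manifold_def by blast
  obtain r :: "nat \<Rightarrow> nat" where r: "strict_mono r" "(x \<circ> r) \<longlonglongrightarrow> xbar"
    using limit_point by blast
  \<comment> \<open>Iteration \<open>q k\<close> produces the point \<open>x (r (Suc k))\<close>.
    Dropping the first term of the subsequence guarantees \<open>r (Suc k) \<ge> 1\<close>, so the
    point is not the initial one.\<close>
  define q where "q k = r (Suc k) - 1" for k
  define z where "z k = x (Suc (q k))" for k
  have Suc_q: "Suc (q k) = r (Suc k)" for k
    using seq_suble[OF r(1), of "Suc k"] unfolding q_def by simp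
  have q: "filterlim q at_top sequentially"
    unfolding filterlim_at_top
  proof
    fix N
    have "N \<le> q k" if "k \<ge> N" for k
      using seq_suble[OF r(1), of "Suc k"] that unfolding q_def by simp
    then show "eventually (\<lambda>k. N \<le> q k) sequentially"
      by (rule eventually_sequentiallyI)
  qed
  have z: "z \<longlonglongrightarrow> xbar"
    using LIMSEQ_Suc[OF r(2)] unfolding z_def Suc_q by (simp add: comp_def)
  note pos = penalty_ralm(1)[OF run inputs, rule_format]
  obtain c where c: "c \<in> A" "xbar \<in> fst c"
    using A by (rule smooth_manifold_obtain_chart)
  note chart = is_chartD[OF smooth_manifold_chart[OF A c(1)]]
  have oc: "open (fst c)"
    using smooth_manifold_chart[OF A c(1)] unfolding is_chart_def by blast
  have zc: "eventually (\<lambda>k. z k \<in> fst c) sequentially"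
    using z oc c(2) by (rule topological_tendstoD)
  have y: "(\<lambda>k. snd c (z k)) \<longlonglongrightarrow> snd c xbar"
    using chart(3)[OF c(2)] z by (rule filterlim_compose)

  \<comment> \<open>The augmented Lagrangian in coordinates\<close>
  define con where "con l = (if l \<in> {1..n} then g l else h l)" for l
  \<comment> \<open>These are the coefficients of the constraint gradients in the gradient of the
    augmented Lagrangian. Unlike the clipped \<open>lam\<close> and \<open>gam\<close> they have no
    a priori bound; their limits will be the KKT multipliers.\<close>
  define mu where "mu k l = (if l \<in> {1..n} then max 0 (lam (q k) l + rho (q k) * g l (z k))
    else gam (q k) l + rho (q k) * h l (z k))" for k l
  define dF where "dF F y = frechet_derivative (F \<circ> param c) (at y)" for F :: "'a \<Rightarrow> real" and y
  define S where "S = active_set n m g xbar"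
  have S: "finite S" "S \<subseteq> {1..n+m}"
    unfolding S_def active_set_def by auto
  have con_C2: "Ck_function A 2 (con l)" if "l \<in> {1..n+m}" for l
    using that g_C2 h_C2 unfolding con_def by auto
  have split: "{1..n+m} = {1..n} \<union> {n+1..n+m}" "{1..n} \<inter> {n+1..n+m} = {}"
    by auto

  have deriv: "((F \<circ> param c) has_derivative dF F (snd c p)) (at (snd c p))"
    if "Ck_function A 2 F" "p \<in> fst c" for F :: "'a \<Rightarrow> real" and p
    unfolding dF_def using that(1) c(1) that(2) by (rule Ck_function_2_chart)
  have dF_lim: "(\<lambda>k. dF F (snd c (z k)) u) \<longlonglongrightarrow> dF F (snd c xbar) u"
    if "Ck_function A 2 F" for F u
    unfolding dF_def using Ck_function_2_chart(2)[OF that c] y by (rule filterlim_compose)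

  \<comment> \<open>The derivative of the augmented Lagrangian in the chart \<open>c\<close>, valid
    once \<open>z k\<close> has entered the chart domain.\<close>
  define D where "D k u = dF f (snd c (z k)) u + (\<Sum>l\<in>{1..n+m}. mu k l * dF (con l) (snd c (z k)) u)" for k u
  have "eventually (\<lambda>k. (((\<lambda>w. aug_lagrangian n m f g h (rho (q k)) w (lam (q k)) (gam (q k))) \<circ> param c)
      has_derivative D k) (at (snd c (z k)))) sequentially"
    using zc
  proof eventually_elim
    case (elim k)
    have "(\<Sum>l\<in>{1..n+m}. mu k l * dF (con l) (snd c (z k)) u) =
        (\<Sum>i\<in>{1..n}. max 0 (lam (q k) i + rho (q k) * g i (param c (snd c (z k)))) * dF (g i) (snd c (z k)) u)
        + (\<Sum>j\<in>{n+1..n+m}. (gam (q k) j + rho (q k) * h j (param c (snd c (z k)))) * dF (h j) (snd c (z k)) u)" for u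
      unfolding split(1) chart(1)[OF elim]
      by (subst sum.union_disjoint) (auto simp: mu_def con_def intro!: arg_cong2[of _ _ _ _ "(+)"] sum.cong)
    then show ?case
      unfolding D_def
      using has_derivative_aug_lagrangian[OF pos, of f "param c" "dF f (snd c (z k))" "snd c (z k)" n g
          "\<lambda>i. dF (g i) (snd c (z k))" m h "\<lambda>j. dF (h j) (snd c (z k))" "q k" "lam (q k)" "gam (q k)"]
        deriv[OF _ elim] f_C2 g_C2 h_C2
      by simp
  qed
  moreover have "eventually (\<lambda>k. tnorm G (z k) (grad A G
      (\<lambda>w. aug_lagrangian n m f g h (rho (q k)) w (lam (q k)) (gam (q k))) (z k)) \<le> eps (q k)) sequentially"
    unfolding z_def using subsolver by (intro always_eventually allI)
  moreover have "(\<lambda>k. eps (q k)) \<longlonglongrightarrow> 0"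
    using tolerance_ralm_tendsto_zero[OF run[unfolded eps_min] inputs[unfolded eps_min]] q
    by (rule filterlim_compose)
  ultimately have D_lim: "(\<lambda>k. D k u) \<longlonglongrightarrow> 0" for u
    by (rule approximate_stationarity_limit[OF riem c z])

  \<comment> \<open>Elimination of the inactive constraints\<close>
  have inactive: "eventually (\<lambda>k. mu k l = 0) sequentially" if "l \<in> {1..n+m} - S" for l
  proof -
    \<comment> \<open>All equality indices belong to \<open>S\<close>, so an index outside it is
      that of an inequality, strict at \<open>xbar\<close> by feasibility.\<close>
    have l: "l \<in> {1..n}" "g l xbar < 0"
      using that feasible unfolding S_def active_set_def feasible_set_def by (auto simp: less_le)
    have "(\<lambda>k. g l (z k)) \<longlonglongrightarrow> g l xbar"
      using Ck_function_2_tendsto[OF A g_C2[OF l(1)]] z by (rule filterlim_compose)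
    then show ?thesis
      using inactive_multiplier_ralm_vanishes[OF run inputs l(1) q, of "g l xbar"] l
      unfolding mu_def z_def by simp
  qed
  have sum_lim: "(\<lambda>k. \<Sum>l\<in>S. mu k l * dF (con l) (snd c (z k)) u) \<longlonglongrightarrow> - dF f (snd c xbar) u" for u
  proof -
    have "eventually (\<lambda>k. \<forall>l\<in>{1..n+m} - S. mu k l = 0) sequentially"
      using inactive by (intro eventually_ball_finite) auto
    then have "eventually (\<lambda>k. D k u - dF f (snd c (z k)) u =
        (\<Sum>l\<in>S. mu k l * dF (con l) (snd c (z k)) u)) sequentially"
    proof eventually_elim
      case (elim k)
      show ?case
        unfolding D_def using S elim
        by (simp add: sum.mono_neutral_left[of "{1..n+m}" S])
    qed
    moreover have "(\<lambda>k. D k u - dF f (snd c (z k)) u) \<longlonglongrightarrow> 0 - dF f (snd c xbar) u"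
      by (intro tendsto_diff D_lim dF_lim f_C2)
    ultimately show ?thesis
      using Lim_transform_eventually by fastforce
  qed

  \<comment> \<open>Convergence of the active multipliers\<close>
  interpret subspace_inner_product "tangent_space A xbar" "G xbar"
    using riem by (rule riemannian_subspace_inner_product)
  have grad: "grad A G F xbar \<in> tangent_space A xbar"
      "v \<in> tangent_space A xbar \<Longrightarrow> G xbar (grad A G F xbar) v = dF F (snd c xbar) (tcoord v c)"
    if "Ck_function A 2 F" for F v
    using grad_of_has_derivative[OF riem c deriv[OF that c(2)]] by blast+
  define w where "w l = grad A G (con l) xbar" for l
  have wT: "w l \<in> tangent_space A xbar" if "l \<in> S" for l
    unfolding w_def using that S(2) by (intro grad con_C2) auto
  have "independent_family S w"
    using licq unfolding LICQ_def S_def w_def con_def by (simp add: if_distrib[of "\<lambda>F. grad A G F xbar"])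
  then have "\<forall>t\<in>S. \<exists>v\<in>tangent_space A xbar. \<forall>s\<in>S. G xbar (w s) v = (if s = t then 1 else 0)"
    using dual_vector[OF S(1), of w, OF _ wT] by blast
  then obtain v where v: "\<And>t. t \<in> S \<Longrightarrow> v t \<in> tangent_space A xbar"
    "\<And>s t. s \<in> S \<Longrightarrow> t \<in> S \<Longrightarrow> G xbar (w s) (v t) = (if s = t then 1 else 0)"
    by metis
  \<comment> \<open>The candidate limit is obtained by testing stationarity against the dual vector
    \<open>v t\<close>, whose coordinates at \<open>xbar\<close> are held fixed along the
    iterates.\<close>
  define beta where "beta t = - dF f (snd c xbar) (tcoord (v t) c)" for t
  have beta: "(\<lambda>k. mu k t) \<longlonglongrightarrow> beta t" if "t \<in> S" for t
  \<comment> \<open>The matrix consists of the derivatives of the active constraints at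
    \<open>z k\<close> in the directions of the dual vectors. By duality it is the identity at
    \<open>xbar\<close>, and continuity gives the convergence.\<close>
  proof (rule solution_tendsto_of_matrix_tendsto_identity[OF S(1) _ _ that])
    fix s t assume st: "s \<in> S" "t \<in> S"
    have "dF (con s) (snd c xbar) (tcoord (v t) c) = (if s = t then 1 else 0)"
      using v[OF st(2)] v(2)[OF st] grad(2)[OF con_C2, of s "v t"] st S(2) unfolding w_def by force
    then show "(\<lambda>k. dF (con s) (snd c (z k)) (tcoord (v t) c)) \<longlonglongrightarrow> (if s = t then 1 else 0)"
      using dF_lim[OF con_C2, of s "tcoord (v t) c"] st S(2) by force
  next
    fix t
    show "(\<lambda>k. \<Sum>s\<in>S. mu k s * dF (con s) (snd c (z k)) (tcoord (v t) c)) \<longlonglongrightarrow> beta t"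
      unfolding beta_def by (rule sum_lim)
  qed
  \<comment> \<open>With the multipliers known to converge, \<open>sum_lim\<close> can be passed to
    the limit in every direction \<open>u\<close>, beyond the dual ones used to find
    \<open>beta\<close>.\<close>
  have stationary: "dF f (snd c xbar) u + (\<Sum>l\<in>S. beta l * dF (con l) (snd c xbar) u) = 0" for u
  proof -
    have "(\<lambda>k. \<Sum>l\<in>S. mu k l * dF (con l) (snd c (z k)) u) \<longlonglongrightarrow> (\<Sum>l\<in>S. beta l * dF (con l) (snd c xbar) u)"
      using S(2) by (intro tendsto_sum tendsto_mult beta dF_lim con_C2) auto
    then show ?thesis
      using LIMSEQ_unique[OF sum_lim] by fastforce
  qed

  \<comment> \<open>The KKT conditions at the limit point\<close>
  define ell where "ell l = (if l \<in> S then beta l else 0)" for l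
  have sumT: "(\<Sum>l\<in>S. beta l *\<^sub>R w l) \<in> tangent_space A xbar"
    using wT subspace by (intro subspace_sum subspace_scale)
  have "grad A G f xbar + (\<Sum>l\<in>S. beta l *\<^sub>R w l) = 0"
  \<comment> \<open>Both sides are tangent vectors, so it is enough to compare their inner products
    with all tangent vectors, where \<open>stationary\<close> applies.\<close>
  proof (rule eq_if_ip_eq)
    fix v assume v: "v \<in> tangent_space A xbar"
    have "G xbar (grad A G f xbar + (\<Sum>l\<in>S. beta l *\<^sub>R w l)) v
        = dF f (snd c xbar) (tcoord v c) + (\<Sum>l\<in>S. beta l * G xbar (w l) v)"
      using ip_add[OF grad(1)[OF f_C2] sumT v] ip_sum[of S w v beta, OF wT v] grad(2)[OF f_C2 v] by simp
    also have "(\<Sum>l\<in>S. beta l * G xbar (w l) v) = (\<Sum>l\<in>S. beta l * dF (con l) (snd c xbar) (tcoord v c))"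
      unfolding w_def using S(2) v by (intro sum.cong refl arg_cong2[of _ _ _ _ "(*)"] grad con_C2) auto
    finally show "G xbar (grad A G f xbar + (\<Sum>l\<in>S. beta l *\<^sub>R w l)) v = G xbar 0 v"
      using stationary ip_zero[OF v] by simp
  qed (use grad(1)[OF f_C2] sumT subspace in \<open>auto intro: subspace_add subspace_0\<close>)
  moreover have "(\<Sum>l\<in>S. beta l *\<^sub>R w l) = (\<Sum>l\<in>{1..n+m}. ell l *\<^sub>R w l)"
    using S by (intro sum.mono_neutral_cong_left) (auto simp: ell_def)
  moreover have "\<dots> = (\<Sum>i\<in>{1..n}. ell i *\<^sub>R grad A G (g i) xbar)
      + (\<Sum>j\<in>{n+1..n+m}. ell j *\<^sub>R grad A G (h j) xbar)"
    unfolding split(1)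
    by (subst sum.union_disjoint) (auto simp: w_def con_def intro!: arg_cong2[of _ _ _ _ "(+)"] sum.cong)
  ultimately have "grad A G f xbar + (\<Sum>i\<in>{1..n}. ell i *\<^sub>R grad A G (g i) xbar)
      + (\<Sum>j\<in>{n+1..n+m}. ell j *\<^sub>R grad A G (h j) xbar) = 0"
    by (simp add: add.assoc)
  moreover have "ell i \<ge> 0" "ell i * g i xbar = 0" if "i \<in> {1..n}" for i
  proof -
    show "ell i \<ge> 0"
    proof (cases "i \<in> S")
      case True
      \<comment> \<open>For inequality indices \<open>mu\<close> is a maximum with 0, and
        nonnegativity survives the limit.\<close>
      have "0 \<le> beta i"
        using beta[OF True] by (rule LIMSEQ_le_const) (use that in \<open>auto simp: mu_def\<close>)
      then show ?thesis
        using True by (simp add: ell_def)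
    qed (simp add: ell_def)
    show "ell i * g i xbar = 0"
      \<comment> \<open>Either \<open>i\<close> is active and \<open>g i xbar\<close> is 0, or
        \<open>ell i\<close> is 0 by the extension.\<close>
      using that unfolding ell_def S_def active_set_def by auto
  qed
  ultimately show ?thesis
    using feasible unfolding KKT_def feasible_set_def by (intro exI[of _ ell]) auto
qed

end
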